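(* Let $w\in\mathcal{BC}_n$. There exists a unique ("bottom") $b$-signed pipe dream $D_b\in\mathrm{PD}_{\mathcal B_n}(w)$ that satisfies the following conditions: (1) $D_b$ contains no fragment "elbow immediately followed on the right by a cross", where the elbow is either a double elbow or a single elbow (without a faucet); (2) the numbers of significant elements in its $\Gamma$-blocks $1,2,3,\dots$ form a strictly decreasing sequence ending by zeroes. This pipe dream $D_b$ can be constructed as follows. Let $(L(w),N(w))$ be the signed Lehmer code of $w$. For each $i=1,\dots,n$ the $i$-th row of the staircase block of $D_b$ contains $L_i(w)$ left-adjusted crosses, and for each $j=1,\dots,s(w)$ the horizontal part of the $j$-th $\Gamma$-block contains $N_j(w)$ left-adjusted significant elements (i.e. an elbow with a faucet in the corner and $N_j(w)-1$ crosses in the boxes immediately following it); there are no other significant elements. Moreover, each $b$-signed pipe dream $D\in\mathrm{PD}_{\mathcal B_n}(w)$ can be brought to $D_b$ by a sequence of admissible moves.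
   Context: **Group.** $\mathcal{BC}_n$ (also denoted $\mathcal B_n$) is the group of permutations $w$ of $\{\pm1,\dots,\pm n\}$ with $w(-i)=-w(i)$, generated by $s_0=(1\leftrightarrow -1)$ and $s_i=(i\leftrightarrow i+1)$ (also exchanging $-i,-(i+1)$), $1\le i\le n-1$; products are compositions of maps, $(uv)(i)=u(v(i))$. $s(w)$ is the number of $i\in\{1,\dots,n\}$ with $w(i)<0$. **Signed Lehmer code.** $L(w)=(L_1(w),\dots,L_n(w))$ with $L_i(w)=\#\{j: i<j\le n,\ w(i)>w(j)\}$, and $N(w)=(N_1(w)>\dots>N_{s(w)}(w))$ is the decreasing sequence of all $m\in\{1,\dots,n\}$ with $w^{-1}(m)<0$. **$b$-signed pipe dreams.** The base $B_{\mathcal B_n}$ consists of a staircase block and infinitely many $\Gamma$-blocks numbered $1,2,3,\dots$ from bottom to top, all lying above the staircase block. The staircase block has boxes $(i,j)$, $1\le i\le n-1$, $1\le j\le n-i$ (row $i$ from the top, column $j$ from the left; row $n$ is empty); the box $(i,j)$ is indexed by $i+j-1$. Each $\Gamma$-block consists of a corner box indexed $0$, boxes indexed $1,\dots,n-1$ from left to right in the same row as the corner and to its right (together with the corner: the horizontal part), and boxes indexed $1,\dots,n-1$ from top to bottom in a column below the corner (together with the corner: the vertical part). A $b$-signed pipe dream $D$ is a filling of the base in which each corner contains either a single elbow or an elbow with a faucet, and every other box contains either a double elbow or a cross. Significant elements are crosses and elbows with a faucet; only finitely many of them are allowed. A cross in a box of index $i$ contributes the letter $s_i$, an elbow with a faucet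 the letter $s_0$, other elements contribute nothing. $\mathrm{word}(D)$ is obtained by reading the letters from top to bottom and in each row from right to left: i.e. the $\Gamma$-blocks in decreasing order of their numbers, in each of them first the horizontal boxes $n-1,\dots,1$, then the corner, then the vertical boxes $1,\dots,n-1$; then the staircase rows $1,\dots,n-1$, each from right to left. $D$ is reduced of shape $w$ if $\mathrm{word}(D)$ is a reduced word of $w$; $\mathrm{PD}_{\mathcal B_n}(w)$ is the set of all reduced $b$-signed pipe dreams of shape $w$. **Left neighbours (for fragments).** The left neighbour of a staircase box $(i,j)$ with $j\ge2$ is $(i,j-1)$; boxes $(i,1)$ have no left neighbour. The left neighbour of the horizontal box $i\ge1$ of a $\Gamma$-block is the horizontal box $i-1$ of that block (the corner if $i=1$). The left neighbour of any non-corner vertical box of a $\Gamma$-block is a cell outside the base, which by convention always contains an elbow without a faucet (so a cross in a non-corner vertical box always forms a forbidden fragment). "Left-adjusted" in a row means occupying the leftmost boxes of that row (of the staircase block, or of the horizontal part including the corner). **Admissible moves.** Rows are ordered vertically: blocks with larger number lie above those with smaller number, which lie above the staircase block; within a $\Gamma$-block the row of the horizontal part (which contains the corner) lies above the vertical boxes $1,2,\dots,n-1$, which lie in successive lower rows; staircase row $i$ lies above row $i+1$. $D$ is obtained from $D'$ by an admissible move if $D,D'$ are reduced pipe dreams of the same shape which coincide except in two boxes $a,b$, the row of $a$ being strictly above the row of $b$, and either $a$ contains a cross in $D'$ and a double elbow in $D$ while $b$ contains a double elbow in $D'$ and a cross in $D$; or $a$ contains an elbow with a faucet in $D'$ and a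 single elbow in $D$ while $b$ contains a single elbow in $D'$ and an elbow with a faucet in $D$. *)

theory Defs
  imports "HOL-Combinatorics.Permutations" "HOL-Library.FuncSet"
begin

definition BC :: "nat \<Rightarrow> (int \<Rightarrow> int) set" where
  "BC n = {w. w permutes ({- int n..int n} - {0}) \<and> (\<forall>i. w (- i) = - w i)}"

definition gen :: "nat \<Rightarrow> int \<Rightarrow> int" where
  "gen a = (if a = 0 then Transposition.transpose 1 (- 1)
            else Transposition.transpose (int a) (int a + 1) \<circ>
                 Transposition.transpose (- int a) (- (int a + 1)))"

definition word_prod :: "nat list \<Rightarrow> int \<Rightarrow> int" where
  "word_prod u = foldr (\<lambda>a f. gen a \<circ> f) u id"

definition reduced_word :: "nat \<Rightarrow> nat list \<Rightarrow> (int \<Rightarrow> int) \<Rightarrow> bool" where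
  "reduced_word n u w \<longleftrightarrow>
     set u \<subseteq> {..<n} \<and> word_prod u = w \<and>
     (\<forall>v. set v \<subseteq> {..<n} \<and> word_prod v = w \<longrightarrow> length u \<le> length v)"


definition num_neg :: "nat \<Rightarrow> (int \<Rightarrow> int) \<Rightarrow> nat" where
  "num_neg n w = card {i \<in> {1..n}. w (int i) < 0}"

definition code_L :: "nat \<Rightarrow> (int \<Rightarrow> int) \<Rightarrow> nat \<Rightarrow> nat" where
  "code_L n w i = card {j. i < j \<and> j \<le> n \<and> w (int i) > w (int j)}"

definition code_N_list :: "nat \<Rightarrow> (int \<Rightarrow> int) \<Rightarrow> nat list" where
  "code_N_list n w = rev (sorted_list_of_set {m \<in> {1..n}. inv w (int m) < 0})"

text \<open>The entries of \<open>N(w)\<close> are numbered from 1.\<close>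

definition code_N :: "nat \<Rightarrow> (int \<Rightarrow> int) \<Rightarrow> nat \<Rightarrow> nat" where
  "code_N n w j = code_N_list n w ! (j - 1)"


text \<open>\<open>Stair i j\<close> is the staircase box in row \<open>i\<close> and column \<open>j\<close>; \<open>Corner k\<close>, \<open>Horiz k i\<close> and
  \<open>Vert k i\<close> are the corner and the boxes indexed \<open>i\<close> in the horizontal and the vertical part of
  the \<open>k\<close>-th \<open>\<Gamma>\<close>-block.\<close>

datatype box = Stair nat nat | Corner nat | Horiz nat nat | Vert nat nat

datatype element = Single_Elbow | Faucet_Elbow | Double_Elbow | Cross

definition base :: "nat \<Rightarrow> box set" where
  "base n = {Stair i j | i j. 1 \<le> i \<and> i \<le> n - 1 \<and> 1 \<le> j \<and> j \<le> n - i}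
          \<union> {Corner k | k. 1 \<le> k}
          \<union> {Horiz k i | k i. 1 \<le> k \<and> 1 \<le> i \<and> i \<le> n - 1}
          \<union> {Vert k i | k i. 1 \<le> k \<and> 1 \<le> i \<and> i \<le> n - 1}"

fun box_index :: "box \<Rightarrow> nat" where
  "box_index (Stair i j) = i + j - 1"
| "box_index (Corner k) = 0"
| "box_index (Horiz k i) = i"
| "box_index (Vert k i) = i"

text \<open>The staircase block gets number 0, so that a block with a larger number lies higher.\<close>

fun block :: "box \<Rightarrow> nat" where
  "block (Stair i j) = 0"
| "block (Corner k) = k"
| "block (Horiz k i) = k"
| "block (Vert k i) = k"

text \<open>Rows inside one block, counted from top to bottom.\<close>

fun row_in_block :: "box \<Rightarrow> nat" where
  "row_in_block (Stair i j) = i"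
| "row_in_block (Corner k) = 0"
| "row_in_block (Horiz k i) = 0"
| "row_in_block (Vert k i) = i"

definition row_above :: "box \<Rightarrow> box \<Rightarrow> bool" where
  "row_above a b \<longleftrightarrow>
     block b < block a \<or> (block a = block b \<and> row_in_block a < row_in_block b)"

fun allowed :: "box \<Rightarrow> element set" where
  "allowed (Corner k) = {Single_Elbow, Faucet_Elbow}"
| "allowed _ = {Double_Elbow, Cross}"

definition significant_boxes :: "nat \<Rightarrow> (box \<Rightarrow> element) \<Rightarrow> box set" where
  "significant_boxes n D = {b \<in> base n. D b \<in> {Cross, Faucet_Elbow}}"

text \<open>Fillings are extensional functions (\<open>undefined\<close> outside the base), so that equality of
  functions is equality of pipe dreams.\<close>

definition pipe_dreams :: "nat \<Rightarrow> (box \<Rightarrow> element) set" where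
  "pipe_dreams n = {D \<in> (\<Pi>\<^sub>E b\<in>base n. allowed b). finite (significant_boxes n D)}"


definition gamma_reading :: "nat \<Rightarrow> nat \<Rightarrow> box list" where
  "gamma_reading n k = map (Horiz k) (rev [1..<n]) @ [Corner k] @ map (Vert k) [1..<n]"

definition stair_reading :: "nat \<Rightarrow> box list" where
  "stair_reading n = concat (map (\<lambda>i. map (Stair i) (rev [1..<Suc (n - i)])) [1..<n])"

definition top_block :: "nat \<Rightarrow> (box \<Rightarrow> element) \<Rightarrow> nat" where
  "top_block n D = Max (insert 0 (block ` significant_boxes n D))"

definition letters :: "(box \<Rightarrow> element) \<Rightarrow> box \<Rightarrow> nat list" where
  "letters D b = (case D b of Cross \<Rightarrow> [box_index b] | Faucet_Elbow \<Rightarrow> [0] | _ \<Rightarrow> [])"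

text \<open>The blocks above \<open>top_block n D\<close> contribute no letters, so the reading starts there.\<close>

definition pd_word :: "nat \<Rightarrow> (box \<Rightarrow> element) \<Rightarrow> nat list" where
  "pd_word n D =
     concat (map (letters D)
       (concat (map (gamma_reading n) (rev [1..<Suc (top_block n D)])) @ stair_reading n))"

definition PD :: "nat \<Rightarrow> (int \<Rightarrow> int) \<Rightarrow> (box \<Rightarrow> element) set" where
  "PD n w = {D \<in> pipe_dreams n. reduced_word n (pd_word n D) w}"


text \<open>What stands immediately to the left of a box; \<open>None\<close> if there is no left neighbour. To the
  left of a vertical box there is a cell outside the base, which by convention holds an elbow
  without a faucet.\<close>

fun left_content :: "(box \<Rightarrow> element) \<Rightarrow> box \<Rightarrow> element option" where
  "left_content D (Stair i j) = (if 2 \<le> j then Some (D (Stair i (j - 1))) else None)"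
| "left_content D (Corner k) = None"
| "left_content D (Horiz k i) = Some (if i = 1 then D (Corner k) else D (Horiz k (i - 1)))"
| "left_content D (Vert k i) = Some Double_Elbow"

definition no_elbow_cross :: "nat \<Rightarrow> (box \<Rightarrow> element) \<Rightarrow> bool" where
  "no_elbow_cross n D \<longleftrightarrow>
     \<not> (\<exists>b\<in>base n. D b = Cross \<and> left_content D b \<in> {Some Double_Elbow, Some Single_Elbow})"

definition gamma_count :: "nat \<Rightarrow> (box \<Rightarrow> element) \<Rightarrow> nat \<Rightarrow> nat" where
  "gamma_count n D k = card {b \<in> significant_boxes n D. block b = k}"

definition decreasing_counts :: "nat \<Rightarrow> (box \<Rightarrow> element) \<Rightarrow> bool" where
  "decreasing_counts n D \<longleftrightarrow>
     (\<exists>r. (\<forall>j k. 1 \<le> j \<and> j < k \<and> k \<le> r \<longrightarrow> gamma_count n D k < gamma_count n D j) \<and>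
          (\<forall>k>r. gamma_count n D k = 0))"

definition code_boxes :: "nat \<Rightarrow> (int \<Rightarrow> int) \<Rightarrow> box set" where
  "code_boxes n w =
       {Stair i j | i j. 1 \<le> i \<and> i \<le> n \<and> 1 \<le> j \<and> j \<le> code_L n w i}
     \<union> {Corner k | k. 1 \<le> k \<and> k \<le> num_neg n w}
     \<union> {Horiz k i | k i. 1 \<le> k \<and> k \<le> num_neg n w \<and> 1 \<le> i \<and> i \<le> code_N n w k - 1}"


text \<open>\<open>admissible_move n D' D\<close>: the pipe dream \<open>D\<close> is obtained from \<open>D'\<close>.\<close>

definition admissible_move :: "nat \<Rightarrow> (box \<Rightarrow> element) \<Rightarrow> (box \<Rightarrow> element) \<Rightarrow> bool" where
  "admissible_move n D' D \<longleftrightarrow>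
     (\<exists>w\<in>BC n. D' \<in> PD n w \<and> D \<in> PD n w) \<and>
     (\<exists>a\<in>base n. \<exists>b\<in>base n. row_above a b \<and>
        (\<forall>c\<in>base n - {a, b}. D c = D' c) \<and>
        (D' a = Cross \<and> D a = Double_Elbow \<and> D' b = Double_Elbow \<and> D b = Cross \<or>
         D' a = Faucet_Elbow \<and> D a = Single_Elbow \<and> D' b = Single_Elbow \<and> D b = Faucet_Elbow))"

end

theory Submission
  imports Defs
begin

text \<open>A pipe dream is determined by its set of significant boxes. If a significant element has letter
  \<open>s\<^sub>a\<close> and \<open>s\<^sub>a v = v s\<^sub>b\<close>, where \<open>v\<close> is the part of the word read between it and a later box of
  index \<open>b\<close>, then the element can be moved to that box; by reducedness the box was not occupied.
  Choosing the lowest violation of (1) or (2), everything below it is left-adjusted, and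
  commutations and braid relations always carry the offending letter to a free lower box. Moves
  lower the total height of the significant elements, so they lead from every pipe dream to one
  that satisfies (1) and (2). Such a pipe dream spells
  \<open>w = q p\<close> with \<open>p\<close> unsigned and \<open>q\<close> increasing on the positive integers, whence the row lengths of
  the staircase are the Lehmer code of \<open>p\<close>, that is, of \<open>w\<close>, and the block counts are the negated
  values of \<open>q\<close>. This gives uniqueness; existence follows because every reduced word of \<open>w\<close> is the
  word of some pipe dream.\<close>

section \<open>Words in the generators\<close>

lemma word_prod_Nil [simp]: "word_prod [] = id"
  by (simp add: word_prod_def)

lemma word_prod_Cons [simp]: "word_prod (a # u) = gen a \<circ> word_prod u"
  by (simp add: word_prod_def)

lemma word_prod_append [simp]: "word_prod (u @ v) = word_prod u \<circ> word_prod v"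
  by (induction u) (simp_all add: comp_assoc)

lemma gen_0: "gen 0 x = (if x = 1 then -1 else if x = -1 then 1 else x)"
  by (auto simp: gen_def Transposition.transpose_def)

lemma gen_pos:
  assumes "a \<ge> 1"
  shows "gen a x = (if x = int a then int a + 1 else if x = int a + 1 then int a
    else if x = - int a then - int a - 1 else if x = - int a - 1 then - int a else x)"
  using assms by (auto simp: gen_def Transposition.transpose_def)

lemma gen_gen [simp]: "gen a (gen a x) = x"
  by (cases "a = 0") (auto simp: gen_0 gen_pos)

lemma gen_involution [simp]: "gen a \<circ> gen a = id"
  by (simp add: fun_eq_iff)

lemma gen_uminus: "gen a (- x) = - gen a x"
  by (cases "a = 0") (auto simp: gen_0 gen_pos)

lemma word_prod_uminus: "word_prod u (- x) = - word_prod u x"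
  by (induction u) (simp_all add: gen_uminus)

section \<open>Commutation and braid relations: letters passing through words\<close>

lemma gen_commute:
  assumes "Suc a < b \<or> Suc b < a"
  shows "gen a \<circ> gen b = gen b \<circ> gen a"
proof -
  have main: "gen a (gen b x) = gen b (gen a x)" if "Suc a < b" for a b x
  proof -
    \<comment> \<open>\<open>gen c\<close> moves only numbers of absolute value \<open>c\<close> or
      \<open>c + 1\<close>. Below \<open>b\<close> only \<open>gen a\<close> can act, above
      \<open>a + 1\<close> only \<open>gen b\<close>, and neither leaves its region.\<close>
    have fixed: "gen c y = y" if "\<bar>y\<bar> < int c \<or> int c + 1 < \<bar>y\<bar>" for c y
      using that by (cases "c = 0") (auto simp: gen_0 gen_pos)
    have upper: "\<bar>gen b x\<bar> > int a + 1" if "\<bar>x\<bar> > int a + 1"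
      using that \<open>Suc a < b\<close> by (auto simp: gen_pos)
    have lower: "\<bar>gen a x\<bar> < int b" if "\<bar>x\<bar> < int b"
      using that \<open>Suc a < b\<close> by (cases "a = 0") (auto simp: gen_0 gen_pos)
    show ?thesis
    proof (cases "\<bar>x\<bar> < int b")
      case True
      then show ?thesis using fixed lower by simp
    next
      case False
      with \<open>Suc a < b\<close> have "\<bar>x\<bar> > int a + 1" by linarith
      then show ?thesis using fixed upper by simp
    qed
  qed
  have "gen a (gen b x) = gen b (gen a x)" for x
    using assms main[of a b x] main[of b a x] by argo
  then show ?thesis by (simp add: fun_eq_iff)
qed

lemma gen_braid:
  assumes "a \<ge> 1"
  shows "gen a \<circ> (gen (Suc a) \<circ> gen a) = gen (Suc a) \<circ> (gen a \<circ> gen (Suc a))"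
proof
  fix x
  consider "x = int a" | "x = int a + 1" | "x = int a + 2" | "x = - int a" | "x = - int a - 1"
    | "x = - int a - 2" | "\<bar>x\<bar> < int a \<or> int a + 2 < \<bar>x\<bar>"
    by linarith
  then show "(gen a \<circ> (gen (Suc a) \<circ> gen a)) x = (gen (Suc a) \<circ> (gen a \<circ> gen (Suc a))) x"
    using assms
  proof cases
    case 7
    then have "x \<noteq> int a" "x \<noteq> int a + 1" "x \<noteq> int a + 2" "x \<noteq> - int a" "x \<noteq> - int a - 1"
      "x \<noteq> - int a - 2"
      by linarith+
    then show ?thesis using assms by (simp add: gen_pos)
  qed (simp_all add: gen_pos)
qed

lemma gen_word_commute:
  assumes "\<And>b. b \<in> set u \<Longrightarrow> Suc a < b \<or> Suc b < a"
  shows "word_prod (a # u) = word_prod (u @ [a])"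
  using assms
proof (induction u)
  case (Cons b u)
  have IH: "word_prod (a # u) = word_prod (u @ [a])"
    by (rule Cons.IH) (use Cons.prems in auto)
  have "gen a (gen b x) = gen b (gen a x)" for x
    using gen_commute[of a b] Cons.prems by (simp add: fun_eq_iff)
  then show ?case
    using IH by (simp add: fun_eq_iff)
qed simp

text \<open>The letters above \<open>a + 1\<close> commute with \<open>a\<close>, the braid relation
  turns \<open>a, a + 1, a\<close> into \<open>a + 1, a, a + 1\<close>, and the new
  \<open>a + 1\<close> commutes with the letters below \<open>a\<close>.\<close>

lemma gen_pass_descending:
  assumes "a \<ge> 1" "r \<le> a" "Suc a < e"
  shows "word_prod (a # rev [r..<e]) = word_prod (rev [r..<e] @ [Suc a])"
proof -
  have "[r..<e] = [r..<a] @ [a..<e]"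
    using assms by (metis le_add_diff_inverse less_or_eq_imp_le upt_add_eq_append Suc_lessD)
  also have "[a..<e] = a # Suc a # [Suc (Suc a)..<e]"
    using assms by (simp add: upt_conv_Cons)
  finally have split: "rev [r..<e] = rev [Suc (Suc a)..<e] @ Suc a # a # rev [r..<a]"
    by simp
  have hi: "word_prod (a # rev [Suc (Suc a)..<e]) = word_prod (rev [Suc (Suc a)..<e] @ [a])"
    by (rule gen_word_commute) auto
  have lo: "word_prod (Suc a # rev [r..<a]) = word_prod (rev [r..<a] @ [Suc a])"
    by (rule gen_word_commute) auto
  have "word_prod (a # rev [r..<e]) =
      word_prod (a # rev [Suc (Suc a)..<e]) \<circ> (gen (Suc a) \<circ> gen a) \<circ> word_prod (rev [r..<a])"
    unfolding split by (simp add: comp_assoc)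
  also have "\<dots> = word_prod (rev [Suc (Suc a)..<e]) \<circ> (gen a \<circ> (gen (Suc a) \<circ> gen a))
      \<circ> word_prod (rev [r..<a])"
    unfolding hi by (simp add: comp_assoc)
  also have "\<dots> = word_prod (rev [Suc (Suc a)..<e] @ [Suc a, a]) \<circ> word_prod (Suc a # rev [r..<a])"
    unfolding gen_braid[OF assms(1)] by (simp add: comp_assoc)
  also have "\<dots> = word_prod (rev [r..<e] @ [Suc a])"
    unfolding lo split by (simp add: comp_assoc)
  finally show ?thesis .
qed

text \<open>Of two equal runs, the upper one trades its first letter for a letter 1 at the end. The
  case \<open>m = 0\<close> is the type B relation s_1 s_0 s_1 s_0 = s_0 s_1 s_0 s_1. This relation
  repairs block counts that fail to decrease.\<close>

lemma gen_double_descending: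
  "word_prod (rev [0..<Suc (Suc m)] @ rev [0..<Suc (Suc m)]) =
   word_prod (rev [0..<Suc m] @ rev [0..<Suc (Suc m)] @ [1])"
proof (induction m)
  case 0
  show ?case
    by (auto simp: fun_eq_iff gen_0 gen_pos numeral_2_eq_2 upt_rec)
next
  case (Suc m)
  let ?k = "Suc (Suc m)"
  \<comment> \<open>With \<open>x\<close> the run from \<open>m\<close> down to 0 and
    \<open>?k = m + 2\<close>: the second \<open>?k\<close> passes \<open>x\<close> to the left, the
    braid relation acts on \<open>?k, m + 1, ?k\<close>, and what follows the first two letters is
    the left side of the induction hypothesis.\<close>
  define x where "x = word_prod (rev [0..<Suc m])"
  have U: "word_prod (rev [0..<?k]) y = gen (Suc m) (x y)"
    "word_prod (rev [0..<Suc ?k]) y = gen ?k (gen (Suc m) (x y))" for y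
    by (simp_all add: x_def)
  have comm: "x (gen ?k y) = gen ?k (x y)" for y
    using gen_word_commute[of "rev [0..<Suc m]" ?k] by (fastforce simp: x_def fun_eq_iff)
  have braid: "gen ?k (gen (Suc m) (gen ?k y)) = gen (Suc m) (gen ?k (gen (Suc m) y))" for y
    using gen_braid[of "Suc m"] by (simp add: fun_eq_iff)
  have IH: "gen (Suc m) (x (gen (Suc m) (x y))) = x (gen (Suc m) (x (gen 1 y)))" for y
    using fun_cong[OF Suc, of y]
    unfolding word_prod_append comp_apply U x_def[symmetric] by simp
  show ?case
    unfolding fun_eq_iff word_prod_append comp_apply U
    by (simp add: comm braid IH)
qed

section \<open>Generation of the signed permutation group\<close>

lemma word_reaching_top:
  assumes "j \<noteq> 0" "- int n \<le> j" "j \<le> int n"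
  shows "\<exists>u. set u \<subseteq> {..<n} \<and> word_prod u j = int n"
  using assms
proof (induction "nat (int n - j)" arbitrary: j rule: less_induct)
  case less
  show ?case
  proof (cases "j = int n")
    case True
    then show ?thesis by (intro exI[of _ "[]"]) simp
  next
    case False
    \<comment> \<open>The generator that raises \<open>j\<close> to the next nonzero number; for
      \<open>j = -1\<close> it is s_0, which skips 0.\<close>
    define a where "a = (if j > 0 then nat j else nat (- j - 1))"
    have a: "a < n" using less.prems False by (auto simp: a_def)
    have j: "gen a j > j" "gen a j \<noteq> 0" "- int n \<le> gen a j" "gen a j \<le> int n"
      using less.prems False by (cases "a = 0"; auto simp: a_def gen_0 gen_pos split: if_splits)+
    then obtain u where "set u \<subseteq> {..<n}" "word_prod u (gen a j) = int n"
      using less.hyps[of "gen a j"] less.prems by auto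
    with a show ?thesis by (intro exI[of _ "u @ [a]"]) auto
  qed
qed

lemma gen_in_BC: "a < n \<Longrightarrow> gen a \<in> BC n"
proof -
  assume a: "a < n"
  have "gen a permutes ({- int n..int n} - {0})"
  proof (cases "a = 0")
    case True
    then show ?thesis using a by (auto simp: gen_def intro!: permutes_swap_id)
  next
    case False
    then show ?thesis using a
      by (auto simp: gen_def intro!: permutes_compose permutes_swap_id)
  qed
  then show ?thesis by (simp add: BC_def gen_uminus)
qed

lemma BC_compose:
  assumes "u \<in> BC n" "w \<in> BC n"
  shows "u \<circ> w \<in> BC n"
proof -
  have "u \<circ> w permutes ({- int n..int n} - {0})"
    using assms by (intro permutes_compose) (simp_all add: BC_def)
  moreover have "(u \<circ> w) (- i) = - (u \<circ> w) i" for i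
    using assms by (simp add: BC_def)
  ultimately show ?thesis
    unfolding BC_def by blast
qed

lemma word_prod_in_BC: "set u \<subseteq> {..<n} \<Longrightarrow> word_prod u \<in> BC n"
proof (induction u)
  case Nil
  then show ?case using permutes_id by (simp add: BC_def id_def)
next
  case (Cons a u)
  then show ?case
    unfolding word_prod_Cons by (intro BC_compose gen_in_BC) auto
qed

lemma BC_reduce:
  assumes "w \<in> BC (Suc n)" "w (int (Suc n)) = int (Suc n)"
  shows "w \<in> BC n"
proof -
  have p: "w permutes ({- int (Suc n)..int (Suc n)} - {0})" and odd: "\<And>i. w (- i) = - w i"
    using assms by (auto simp: BC_def)
  have "w permutes ({- int n..int n} - {0})"
  proof (rule permutes_superset[OF p])
    fix x assume "x \<in> {- int (Suc n)..int (Suc n)} - {0} - ({- int n..int n} - {0})"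
    then have "x = int (Suc n) \<or> x = - int (Suc n)" by auto
    then show "w x = x" using assms(2) odd[of "int (Suc n)"] by auto
  qed
  with odd show ?thesis by (simp add: BC_def)
qed

lemma word_prod_rev: "word_prod (rev u) \<circ> word_prod u = id"
proof (induction u)
  case (Cons a u)
  have "word_prod (rev (a # u)) \<circ> word_prod (a # u)
      = word_prod (rev u) \<circ> (gen a \<circ> gen a) \<circ> word_prod u"
    by (simp only: rev.simps word_prod_append word_prod_Cons word_prod_Nil comp_id comp_assoc)
  then show ?case using Cons by simp
qed simp

text \<open>Left multiplication by a word that sends \<open>w (n + 1)\<close> back to
  \<open>n + 1\<close> gives an element of the smaller group, to which the induction hypothesis
  applies; the reversed word undoes the multiplication.\<close>

lemma BC_generated: "w \<in> BC n \<Longrightarrow> \<exists>u. set u \<subseteq> {..<n} \<and> word_prod u = w"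
proof (induction n arbitrary: w)
  case 0
  then have "w = id" by (auto simp: BC_def permutes_empty)
  then show ?case by (intro exI[of _ "[]"]) simp
next
  case (Suc n)
  have p: "w permutes ({- int (Suc n)..int (Suc n)} - {0})"
    using Suc.prems by (simp add: BC_def)
  have "w (int (Suc n)) \<in> {- int (Suc n)..int (Suc n)} - {0}"
    using permutes_in_image[OF p, of "int (Suc n)"] by simp
  then obtain v where v: "set v \<subseteq> {..<Suc n}" "word_prod v (w (int (Suc n))) = int (Suc n)"
    using word_reaching_top[of "w (int (Suc n))" "Suc n"] by auto
  have "word_prod v \<circ> w \<in> BC (Suc n)"
    by (intro BC_compose word_prod_in_BC v Suc.prems)
  then have "word_prod v \<circ> w \<in> BC n"
    by (rule BC_reduce) (unfold comp_apply, rule v(2))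
  then obtain u where u: "set u \<subseteq> {..<n}" "word_prod u = word_prod v \<circ> w"
    using Suc.IH by blast
  have "word_prod (rev v @ u) = (word_prod (rev v) \<circ> word_prod v) \<circ> w"
    unfolding word_prod_append u(2) comp_assoc ..
  then have "word_prod (rev v @ u) = w" unfolding word_prod_rev by simp
  moreover have "set (rev v @ u) \<subseteq> {..<Suc n}" using u(1) v(1) by auto
  ultimately show ?case by (intro exI[of _ "rev v @ u"] conjI)
qed

lemma reduced_word_exists:
  assumes "w \<in> BC n"
  shows "\<exists>u. reduced_word n u w"
proof -
  obtain u where "set u \<subseteq> {..<n} \<and> word_prod u = w"
    using BC_generated[OF assms] by blast
  from ex_has_least_nat[of "\<lambda>u. set u \<subseteq> {..<n} \<and> word_prod u = w", OF this, of length]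
  show ?thesis by (auto simp: reduced_word_def)
qed

section \<open>Pipe dreams as sets of boxes\<close>

text \<open>The corner counts as the horizontal box of index 0, so that the horizontal part is a
  single row indexed from 0.\<close>

definition hcell :: "nat \<Rightarrow> nat \<Rightarrow> box" where
  "hcell k i = (if i = 0 then Corner k else Horiz k i)"

text \<open>Addresses a staircase box by its letter \<open>i\<close> in place of its column, so that
  row \<open>r\<close> has the indices \<open>r\<close> to \<open>n - 1\<close>.\<close>

definition scell :: "nat \<Rightarrow> nat \<Rightarrow> box" where
  "scell r i = Stair r (i + 1 - r)"

definition row_reading :: "(nat \<Rightarrow> box) \<Rightarrow> nat \<Rightarrow> nat \<Rightarrow> box list" where
  "row_reading f r n = map f (rev [r..<n])"

text \<open>Here \<open>T\<close> is any bound on the occupied blocks, so that the pipe dreams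
  before and after a move can be read along the same list.\<close>

definition reading :: "nat \<Rightarrow> nat \<Rightarrow> box list" where
  "reading n T = concat (map (gamma_reading n) (rev [1..<Suc T])) @ stair_reading n"

definition subword :: "box set \<Rightarrow> box list \<Rightarrow> nat list" where
  "subword S xs = map box_index (filter (\<lambda>b. b \<in> S) xs)"

fun is_corner :: "box \<Rightarrow> bool" where
  "is_corner (Corner k) = True"
| "is_corner _ = False"

text \<open>Inverse to \<open>significant_boxes\<close>: whether a box is a corner decides which of
  the two significant elements it holds.\<close>

definition dream :: "nat \<Rightarrow> box set \<Rightarrow> box \<Rightarrow> element" where
  "dream n S = (\<lambda>b\<in>base n. if is_corner b then (if b \<in> S then Faucet_Elbow else Single_Elbow)
     else (if b \<in> S then Cross else Double_Elbow))"

lemma box_index_hcell [simp]: "box_index (hcell k i) = i"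
  and block_hcell [simp]: "block (hcell k i) = k"
  and row_in_block_hcell [simp]: "row_in_block (hcell k i) = 0"
  and is_corner_hcell [simp]: "is_corner (hcell k i) \<longleftrightarrow> i = 0"
  by (simp_all add: hcell_def)

lemma box_index_scell [simp]: "r \<le> i \<Longrightarrow> box_index (scell r i) = i"
  and block_scell [simp]: "block (scell r i) = 0"
  and row_in_block_scell [simp]: "row_in_block (scell r i) = r"
  and is_corner_scell [simp]: "\<not> is_corner (scell r i)"
  by (simp_all add: scell_def)

lemma hcell_eq_iff [simp]: "hcell k i = hcell k' i' \<longleftrightarrow> k = k' \<and> i = i'"
  by (simp add: hcell_def)

lemma hcell_neq [simp]: "hcell k i \<noteq> Vert k' i'" "Vert k' i' \<noteq> hcell k i"
  "hcell k i \<noteq> Stair r j" "Stair r j \<noteq> hcell k i"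
  by (simp_all add: hcell_def)

lemma gamma_reading_eq:
  assumes "n \<ge> 1"
  shows "gamma_reading n k = row_reading (hcell k) 0 n @ map (Vert k) [1..<n]"
proof -
  have "[0..<n] = 0 # [1..<n]" using assms by (simp add: upt_conv_Cons)
  then have "map (hcell k) (rev [0..<n]) = map (hcell k) (rev [1..<n]) @ [Corner k]"
    by (simp add: hcell_def)
  moreover have "map (hcell k) (rev [1..<n]) = map (Horiz k) (rev [1..<n])"
    by (auto simp: hcell_def)
  ultimately show ?thesis by (simp add: gamma_reading_def row_reading_def)
qed

lemma stair_reading_eq:
  "stair_reading n = concat (map (\<lambda>r. row_reading (scell r) r n) [1..<n])"
proof -
  have "map (Stair r) (rev [1..<Suc (n - r)]) = row_reading (scell r) r n" if "r \<in> set [1..<n]" for r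
    using that unfolding row_reading_def rev_map[symmetric]
    by (intro arg_cong[of _ _ rev] nth_equalityI) (auto simp: scell_def simp del: upt_Suc)
  then show ?thesis unfolding stair_reading_def
    by (intro arg_cong[of _ _ concat] map_cong) auto
qed

section \<open>The list of boxes in reading order\<close>

lemma reading_0: "reading n 0 = stair_reading n"
  by (simp add: reading_def)

lemma reading_Suc: "reading n (Suc T) = gamma_reading n (Suc T) @ reading n T"
  by (simp add: reading_def)

lemma set_gamma_reading: "n \<ge> 1 \<Longrightarrow> k \<ge> 1 \<Longrightarrow> set (gamma_reading n k) = {b \<in> base n. block b = k}"
  by (auto simp: gamma_reading_def base_def)

lemma set_stair_reading: "set (stair_reading n) = {b \<in> base n. block b = 0}"
proof
  show "set (stair_reading n) \<subseteq> {b \<in> base n. block b = 0}"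
    by (auto simp: stair_reading_def base_def)
  show "{b \<in> base n. block b = 0} \<subseteq> set (stair_reading n)"
  proof clarify
    fix b assume "b \<in> base n" "block b = 0"
    then obtain i j where b: "b = Stair i j" "1 \<le> i" "i \<le> n - 1" "1 \<le> j" "j \<le> n - i"
      by (auto simp: base_def)
    then have "i \<in> {1..<n}" "b \<in> Stair i ` {1..<Suc (n - i)}" by auto
    then show "b \<in> set (stair_reading n)"
      unfolding stair_reading_def set_concat set_map set_rev set_upt UN_simps by (rule UN_I)
  qed
qed

lemma set_reading:
  assumes "n \<ge> 1"
  shows "set (reading n T) = {b \<in> base n. block b \<le> T}"
proof (induction T)
  case 0
  then show ?case by (simp add: reading_0 set_stair_reading)
next
  case (Suc T)
  then show ?case using set_gamma_reading[OF assms, of "Suc T"]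
    by (auto simp: reading_Suc)
qed

lemma distinct_gamma_reading: "distinct (gamma_reading n k)"
  by (auto simp: gamma_reading_def distinct_map inj_on_def)

lemma distinct_stair_reading: "distinct (stair_reading n)"
proof -
  have "distinct (concat (map (\<lambda>i. map (Stair i) (rev [1..<Suc (n - i)])) xs))"
    if "distinct xs" for xs
    using that by (induction xs) (auto simp: distinct_map inj_on_def)
  then show ?thesis by (simp add: stair_reading_def del: upt_Suc)
qed

lemma distinct_reading:
  assumes "n \<ge> 1"
  shows "distinct (reading n T)"
proof (induction T)
  case 0
  then show ?case by (simp add: reading_0 distinct_stair_reading)
next
  case (Suc T)
  then show ?case
    using set_gamma_reading[OF assms, of "Suc T"] set_reading[OF assms, of T]
    by (auto simp: reading_Suc distinct_gamma_reading)
qed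

lemma subword_Nil [simp]: "subword S [] = []"
  and subword_Cons [simp]:
    "subword S (b # xs) = (if b \<in> S then [box_index b] else []) @ subword S xs"
  and subword_append [simp]: "subword S (xs @ ys) = subword S xs @ subword S ys"
  by (simp_all add: subword_def)

lemma subword_empty: "(\<And>b. b \<in> set xs \<Longrightarrow> b \<notin> S) \<Longrightarrow> subword S xs = []"
  by (auto simp: subword_def filter_empty_conv)

lemma subword_cong: "(\<And>b. b \<in> set xs \<Longrightarrow> b \<in> S \<longleftrightarrow> b \<in> S') \<Longrightarrow> subword S xs = subword S' xs"
  by (auto simp: subword_def cong: filter_cong)

lemma set_subword: "set (subword S xs) = box_index ` (S \<inter> set xs)"
  by (auto simp: subword_def)

section \<open>Correspondence between pipe dreams and finite sets of boxes\<close>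

lemma pipe_dream_cases:
  assumes "D \<in> pipe_dreams n" "b \<in> base n"
  shows "is_corner b \<Longrightarrow> b \<in> significant_boxes n D \<Longrightarrow> D b = Faucet_Elbow"
    and "is_corner b \<Longrightarrow> b \<notin> significant_boxes n D \<Longrightarrow> D b = Single_Elbow"
    and "\<not> is_corner b \<Longrightarrow> b \<in> significant_boxes n D \<Longrightarrow> D b = Cross"
    and "\<not> is_corner b \<Longrightarrow> b \<notin> significant_boxes n D \<Longrightarrow> D b = Double_Elbow"
proof -
  have "D b \<in> allowed b"
    using assms by (auto simp: pipe_dreams_def)
  then show "is_corner b \<Longrightarrow> b \<in> significant_boxes n D \<Longrightarrow> D b = Faucet_Elbow"
    and "is_corner b \<Longrightarrow> b \<notin> significant_boxes n D \<Longrightarrow> D b = Single_Elbow"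
    and "\<not> is_corner b \<Longrightarrow> b \<in> significant_boxes n D \<Longrightarrow> D b = Cross"
    and "\<not> is_corner b \<Longrightarrow> b \<notin> significant_boxes n D \<Longrightarrow> D b = Double_Elbow"
    using assms(2) by (cases b; auto simp: significant_boxes_def)+
qed

lemma significant_boxes_base: "significant_boxes n D \<subseteq> base n"
  by (auto simp: significant_boxes_def)

lemma dream_significant_boxes:
  assumes "D \<in> pipe_dreams n"
  shows "dream n (significant_boxes n D) = D"
proof
  fix b
  show "dream n (significant_boxes n D) b = D b"
  proof (cases "b \<in> base n")
    case True
    then show ?thesis using pipe_dream_cases[OF assms True] by (auto simp: dream_def)
  next
    case False
    then show ?thesis using assms by (auto simp: dream_def pipe_dreams_def PiE_def extensional_def)
  qed
qed

lemma significant_boxes_dream: "S \<subseteq> base n \<Longrightarrow> significant_boxes n (dream n S) = S"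
  by (auto simp: significant_boxes_def dream_def split: if_splits)

lemma dream_in_pipe_dreams:
  assumes "S \<subseteq> base n" "finite S"
  shows "dream n S \<in> pipe_dreams n"
proof -
  have "dream n S b \<in> allowed b" if "b \<in> base n" for b
    using that by (cases b) (auto simp: dream_def)
  then have "dream n S \<in> (\<Pi>\<^sub>E b\<in>base n. allowed b)"
    by (auto simp: dream_def)
  with assms show ?thesis by (simp add: pipe_dreams_def significant_boxes_dream)
qed

lemma reading_top_irrelevant:
  assumes "n \<ge> 1" "T \<le> T'" "\<And>b. b \<in> S \<Longrightarrow> block b \<le> T"
  shows "subword S (reading n T') = subword S (reading n T)"
  using assms(2)
proof (induction T' rule: dec_induct)
  case (step m)
  have "subword S (gamma_reading n (Suc m)) = []"
    using set_gamma_reading[OF assms(1), of "Suc m"] assms(3) step.hyps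
    by (intro subword_empty) fastforce
  with step show ?case by (simp add: reading_Suc)
qed simp

text \<open>Blocks above the highest occupied one contribute no letters, so a common bound may
  replace \<open>top_block\<close>.\<close>

lemma pd_word_eq:
  assumes "n \<ge> 1" "D \<in> pipe_dreams n" "\<And>b. b \<in> significant_boxes n D \<Longrightarrow> block b \<le> T"
  shows "pd_word n D = subword (significant_boxes n D) (reading n T)"
proof -
  let ?S = "significant_boxes n D" and ?t = "top_block n D"
  have fin: "finite (block ` ?S)"
    using assms(2) by (simp add: pipe_dreams_def)
  have le: "block b \<le> ?t" if "b \<in> ?S" for b
    unfolding top_block_def using that fin by (intro Max_ge) auto
  have "?t \<le> T"
    unfolding top_block_def using fin assms(3) by (subst Max_le_iff) auto
  have letters: "letters D b = (if b \<in> ?S then [box_index b] else [])" if "b \<in> base n" for b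
    using pipe_dream_cases[OF assms(2) that] by (cases b) (auto simp: letters_def)
  have "concat (map (letters D) xs) = subword ?S xs" if "set xs \<subseteq> base n" for xs
    using that by (induction xs) (auto simp: letters)
  then have "pd_word n D = subword ?S (reading n ?t)"
    using set_reading[OF assms(1), of ?t] unfolding pd_word_def reading_def by fastforce
  then show ?thesis
    using reading_top_irrelevant[OF assms(1) \<open>?t \<le> T\<close> le] by simp
qed

lemma PD_dream_iff:
  assumes "n \<ge> 1" "S \<subseteq> base n" "finite S" "\<And>b. b \<in> S \<Longrightarrow> block b \<le> T"
  shows "dream n S \<in> PD n w \<longleftrightarrow> reduced_word n (subword S (reading n T)) w"
  using pd_word_eq[OF assms(1) dream_in_pipe_dreams[OF assms(2,3)], of T] assms
  by (simp add: PD_def dream_in_pipe_dreams significant_boxes_dream)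

lemma box_index_less: "n \<ge> 1 \<Longrightarrow> b \<in> base n \<Longrightarrow> box_index b < n"
  by (auto simp: base_def)

section \<open>Moving one significant element\<close>

text \<open>Row numbers inside a block are smaller than \<open>n\<close>, so this is a numbering of
  the rows that increases upwards.\<close>

definition height :: "nat \<Rightarrow> box \<Rightarrow> nat" where
  "height n b = block b * n + (n - row_in_block b)"

lemma height_less:
  assumes "n \<ge> 1" "a \<in> base n" "b \<in> base n" "row_above a b"
  shows "height n b < height n a"
proof -
  have row: "row_in_block c < n" if "c \<in> base n" for c
    using that assms(1) by (auto simp: base_def)
  from assms(4) consider "block b < block a"
    | "block a = block b" "row_in_block a < row_in_block b"
    by (auto simp: row_above_def)
  then show ?thesis
  proof cases
    case 1
    then have "block b * n + n \<le> block a * n"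
      using mult_le_mono1[of "Suc (block b)" "block a" n] by simp
    then show ?thesis using row[OF assms(2)] by (simp add: height_def)
  next
    case 2
    then show ?thesis using row[OF assms(3)] by (simp add: height_def)
  qed
qed

text \<open>Termination measure: a move carries one element to a strictly lower row.\<close>

definition weight :: "nat \<Rightarrow> (box \<Rightarrow> element) \<Rightarrow> nat" where
  "weight n D = (\<Sum>b\<in>significant_boxes n D. height n b)"

definition movable :: "nat \<Rightarrow> (int \<Rightarrow> int) \<Rightarrow> (box \<Rightarrow> element) \<Rightarrow> bool" where
  "movable n w D \<longleftrightarrow> (\<exists>D'. D' \<in> PD n w \<and> admissible_move n D D' \<and> weight n D' < weight n D)"

text \<open>If s_a v = v s_b, where v is spelled by the boxes in between, the letter can be read at
  \<open>b\<close> instead, with the same product and length. Were \<open>b\<close> occupied, the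
  two letters would cancel and shorten the word by two, against reducedness.\<close>

lemma movableI:
  assumes n: "n \<ge> 1" and w: "w \<in> BC n" and D: "D \<in> PD n w"
    and S: "S = significant_boxes n D" and T: "\<And>c. c \<in> S \<Longrightarrow> block c \<le> T"
    and reading: "reading n T = A @ a # B @ b # C" and a: "a \<in> S"
    and corner: "is_corner a \<longleftrightarrow> is_corner b" and above: "row_above a b"
    and pass: "word_prod (box_index a # subword S B) = word_prod (subword S B @ [box_index b])"
  shows "movable n w D"
proof -
  define S' where "S' = insert b (S - {a})"
  have Dp: "D \<in> pipe_dreams n" and red: "reduced_word n (pd_word n D) w"
    using D by (auto simp: PD_def)
  have base: "a \<in> base n" "b \<in> base n" "block b \<le> T"
    using set_reading[OF n, of T] reading by auto
  have S_base: "S \<subseteq> base n" and fin: "finite S"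
    using S Dp significant_boxes_base by (auto simp: pipe_dreams_def)
  have dist: "distinct (A @ a # B @ b # C)"
    using distinct_reading[OF n, of T] reading by simp
  have word: "pd_word n D = subword S (A @ a # B @ b # C)"
    using pd_word_eq[OF n Dp] T S reading by metis
  have passA: "word_prod (subword S A @ box_index a # subword S B @ u) =
      word_prod (subword S A @ subword S B @ box_index b # u)" for u
    using arg_cong[OF pass, of "\<lambda>f. word_prod (subword S A) \<circ> (f \<circ> word_prod u)"]
    by (simp add: comp_assoc)
  have b: "b \<notin> S"
  proof
    assume "b \<in> S"
    then have eq: "pd_word n D = subword S A @ box_index a # subword S B @ box_index b # subword S C"
      using a word by simp
    let ?v = "subword S A @ subword S B @ subword S C"
    have "word_prod (pd_word n D) = word_prod (subword S A @ subword S B @ box_index b # box_index b # subword S C)"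
      unfolding eq passA ..
    also have "\<dots> = word_prod ?v"
      by (simp add: fun_eq_iff)
    finally have "word_prod ?v = w" using red by (simp add: reduced_word_def)
    moreover have "set ?v \<subseteq> set (pd_word n D)"
      unfolding eq by auto
    then have "set ?v \<subseteq> {..<n}" using red by (auto simp: reduced_word_def)
    ultimately have "length (pd_word n D) \<le> length ?v"
      using red unfolding reduced_word_def by blast
    then show False unfolding eq by simp
  qed
  have S'_base: "S' \<subseteq> base n" and S'_fin: "finite S'" and S'_T: "\<And>c. c \<in> S' \<Longrightarrow> block c \<le> T"
    using S_base fin base T by (auto simp: S'_def)
  have "subword S' A = subword S A" "subword S' B = subword S B" "subword S' C = subword S C"
    using dist by (auto simp: S'_def intro!: subword_cong)
  then have word': "subword S' (reading n T) = subword S A @ subword S B @ box_index b # subword S C"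
    using dist by (simp add: reading S'_def)
  have word: "pd_word n D = subword S A @ box_index a # subword S B @ subword S C"
    using word a b by simp
  have "reduced_word n (subword S' (reading n T)) w"
    using red box_index_less[OF n base(2)] passA[of "subword S C"]
    unfolding reduced_word_def word' word by auto
  then have D': "dream n S' \<in> PD n w"
    using PD_dream_iff[OF n S'_base S'_fin S'_T] by blast
  have D_eq: "D = dream n S"
    using dream_significant_boxes[OF Dp] S by simp
  have "a \<noteq> b" using dist by auto
  have "\<forall>c\<in>base n - {a, b}. dream n S' c = D c"
    unfolding D_eq by (auto simp: dream_def S'_def)
  moreover have "D a = Cross \<and> dream n S' a = Double_Elbow \<and> D b = Double_Elbow \<and> dream n S' b = Cross \<or>
    D a = Faucet_Elbow \<and> dream n S' a = Single_Elbow \<and> D b = Single_Elbow \<and> dream n S' b = Faucet_Elbow"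
    unfolding D_eq using base a b corner \<open>a \<noteq> b\<close> by (auto simp: dream_def S'_def)
  ultimately have "admissible_move n D (dream n S')"
    unfolding admissible_move_def using w D D' base above by blast
  moreover have "weight n (dream n S') < weight n D"
  proof -
    have "weight n (dream n S') = height n b + (\<Sum>c\<in>S - {a}. height n c)"
      using significant_boxes_dream[OF S'_base] fin b by (simp add: weight_def S'_def)
    also have "\<dots> < height n a + (\<Sum>c\<in>S - {a}. height n c)"
      using height_less[OF n base(1,2) above] by simp
    also have "\<dots> = weight n D"
      using a fin S by (simp add: weight_def sum.remove[of _ a])
    finally show ?thesis .
  qed
  ultimately show ?thesis
    using D' by (auto simp: movable_def)
qed

section \<open>Carrying a letter through left-adjusted rows\<close>

definition passes :: "box set \<Rightarrow> box list \<Rightarrow> nat \<Rightarrow> nat \<Rightarrow> bool" where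
  "passes S xs a b \<longleftrightarrow> word_prod (a # subword S xs) = word_prod (subword S xs @ [b])"

text \<open>While \<open>passes\<close> carries a letter across the whole list, a target is a box
  where it can stop on the way. That this box is empty follows later from reducedness; corners are
  excluded because a cross cannot stand there.\<close>

definition target :: "box set \<Rightarrow> box list \<Rightarrow> nat \<Rightarrow> bool" where
  "target S xs a \<longleftrightarrow>
     (\<exists>B b C. xs = B @ b # C \<and> \<not> is_corner b \<and> passes S B a (box_index b))"

lemma passes_append: "passes S xs a b \<Longrightarrow> passes S ys b c \<Longrightarrow> passes S (xs @ ys) a c"
  unfolding passes_def subword_append word_prod_append word_prod_Cons word_prod_Nil fun_eq_iff
  by simp

lemma passes_empty: "subword S xs = [] \<Longrightarrow> passes S xs a a"
  by (simp add: passes_def)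

lemma target_append:
  assumes "passes S xs a c" "target S ys c"
  shows "target S (xs @ ys) a"
proof -
  obtain B b C where "ys = B @ b # C" "\<not> is_corner b" "passes S B c (box_index b)"
    using assms(2) by (auto simp: target_def)
  then show ?thesis unfolding target_def
    using passes_append[OF assms(1)] by (intro exI[of _ "xs @ B"] exI[of _ b] exI[of _ C]) simp
qed

lemma target_append_right:
  assumes "target S xs a"
  shows "target S (xs @ ys) a"
proof -
  obtain B b C where "xs = B @ b # C" "\<not> is_corner b" "passes S B a (box_index b)"
    using assms by (auto simp: target_def)
  then show ?thesis unfolding target_def
    by (intro exI[of _ B] exI[of _ b] exI[of _ "C @ ys"]) simp
qed

lemma movable_targetI:
  assumes "n \<ge> 1" "w \<in> BC n" "D \<in> PD n w" and S: "S = significant_boxes n D"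
    and "\<And>c. c \<in> S \<Longrightarrow> block c \<le> T"
    and reading: "reading n T = A @ a # Y @ Z @ R" and a: "a \<in> S" "\<not> is_corner a"
    and pass: "passes S Y (box_index a) c" and target: "target S Z c"
    and above: "\<And>b. b \<in> set Z \<Longrightarrow> row_above a b"
  shows "movable n w D"
proof -
  obtain B b C where B: "Z = B @ b # C" "\<not> is_corner b" "passes S B c (box_index b)"
    using target by (auto simp: target_def)
  show ?thesis
  proof (rule movableI[OF assms(1-5)])
    show "reading n T = A @ a # (Y @ B) @ b # C @ R" using reading B(1) by simp
    show "word_prod (box_index a # subword S (Y @ B)) = word_prod (subword S (Y @ B) @ [box_index b])"
      using passes_append[OF pass B(3)] by (simp only: passes_def)
  qed (use a B above in auto)
qed

text \<open>Absence of the forbidden fragment in the row \<open>f r, ..., f (n - 1)\<close>, which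
  amounts to the occupied boxes forming an initial segment.\<close>

definition adjusted :: "(nat \<Rightarrow> box) \<Rightarrow> nat \<Rightarrow> nat \<Rightarrow> box set \<Rightarrow> bool" where
  "adjusted f r n S \<longleftrightarrow> (\<forall>i. r < i \<and> i < n \<and> f i \<in> S \<longrightarrow> f (i - 1) \<in> S)"

lemma adjusted_initial_segment:
  assumes "adjusted f r n S" "r \<le> n"
  shows "\<exists>e. r \<le> e \<and> e \<le> n \<and> (\<forall>i. r \<le> i \<and> i < n \<longrightarrow> (f i \<in> S \<longleftrightarrow> i < e))"
  using assms(2,1)
proof (induction n rule: dec_induct)
  case base
  then show ?case by (intro exI[of _ r]) auto
next
  case (step n)
  then have "adjusted f r n S" by (auto simp: adjusted_def)
  with step.IH obtain e where e: "r \<le> e" "e \<le> n" "\<And>i. r \<le> i \<Longrightarrow> i < n \<Longrightarrow> f i \<in> S \<longleftrightarrow> i < e"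
    by blast
  show ?case
  proof (cases "f n \<in> S")
    case True
    have "e = n"
    proof (rule ccontr)
      assume "e \<noteq> n"
      with e(1,2) step.hyps have "r < n" by simp
      then have "f (n - 1) \<in> S" using True step.prems unfolding adjusted_def by simp
      then have "n - 1 < e" using e(3)[of "n - 1"] \<open>r < n\<close> by simp
      then show False using \<open>e \<noteq> n\<close> e(2) by linarith
    qed
    then show ?thesis using True e step.hyps by (intro exI[of _ "Suc n"]) (auto simp: less_Suc_eq)
  next
    case False
    then show ?thesis using e step.hyps by (intro exI[of _ e]) (auto simp: less_Suc_eq)
  qed
qed

lemma subword_row:
  assumes "\<And>i. r \<le> i \<Longrightarrow> box_index (f i) = i" "r \<le> e" "e \<le> n"
    and "\<And>i. r \<le> i \<Longrightarrow> i < n \<Longrightarrow> f i \<in> S \<longleftrightarrow> i < e"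
  shows "subword S (row_reading f r n) = rev [r..<e]"
proof -
  have "[r..<n] = [r..<e] @ [e..<n]"
    using assms(2,3) by (metis le_add_diff_inverse upt_add_eq_append)
  moreover have "subword S (map f (rev [e..<n])) = []"
    using assms by (intro subword_empty) auto
  moreover have "filter (\<lambda>b. b \<in> S) (map f (rev [r..<e])) = map f (rev [r..<e])"
    using assms by (intro filter_True) auto
  then have "subword S (map f (rev [r..<e])) = map (\<lambda>i. box_index (f i)) (rev [r..<e])"
    by (simp add: subword_def)
  moreover have "\<dots> = map (\<lambda>i. i) (rev [r..<e])"
    using assms by (intro map_cong) auto
  ultimately show ?thesis by (simp add: row_reading_def)
qed

lemma row_reading_split:
  assumes "r \<le> i" "i < n"
  shows "row_reading f r n = map f (rev [Suc i..<n]) @ f i # row_reading f r i"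
proof -
  have "[r..<n] = [r..<i] @ i # [Suc i..<n]"
    using assms by (metis le_add_diff_inverse less_imp_le upt_add_eq_append upt_conv_Cons)
  then show ?thesis by (simp add: row_reading_def)
qed

text \<open>A letter \<open>a\<close> entering a left-adjusted row from above can be placed at the box of index \<open>a\<close>
  when no cross stands further right; otherwise a braid relation carries it to the other end as
  \<open>a + 1\<close>.\<close>

lemma row_target_or_passes:
  assumes index: "\<And>i. r \<le> i \<Longrightarrow> box_index (f i) = i" and adj: "adjusted f r n S"
    and a: "1 \<le> a" "r \<le> a" "a < n" "\<not> is_corner (f a)"
  shows "target S (row_reading f r n) a \<or> passes S (row_reading f r n) a (Suc a) \<and> Suc a < n"
proof -
  obtain e where e: "r \<le> e" "e \<le> n" "\<And>i. r \<le> i \<Longrightarrow> i < n \<Longrightarrow> f i \<in> S \<longleftrightarrow> i < e"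
    using adjusted_initial_segment[OF adj] a by (meson le_trans less_imp_le)
  show ?thesis
  proof (cases "Suc a < e")
    case True
    then show ?thesis
      using gen_pass_descending[OF a(1,2) True] subword_row[OF index e] e(2)
      by (auto simp: passes_def)
  next
    case False
    then have "subword S (map f (rev [Suc a..<n])) = []"
      using e a by (intro subword_empty) auto
    then show ?thesis
      unfolding target_def using row_reading_split[OF a(2,3)] passes_empty index[OF a(2)] a(4)
      by metis
  qed
qed

text \<open>In each row the letter stops or enters the next row increased by one, so the bound
  \<open>r \<le> a\<close> persists. Since the letter must stay below \<open>n\<close>, it stops in
  row \<open>n - 1\<close> at the latest.\<close>

lemma stairs_target:
  assumes "r \<le> n" "1 \<le> r" "r \<le> a" "a < n"
    and "\<And>r'. r \<le> r' \<Longrightarrow> r' < n \<Longrightarrow> adjusted (scell r') r' n S"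
  shows "target S (concat (map (\<lambda>r. row_reading (scell r) r n) [r..<n])) a"
  using assms
proof (induction r arbitrary: a rule: inc_induct)
  case base
  then show ?case by simp
next
  case (step r)
  have split: "concat (map (\<lambda>r. row_reading (scell r) r n) [r..<n]) =
      row_reading (scell r) r n @ concat (map (\<lambda>r. row_reading (scell r) r n) [Suc r..<n])"
    using step.hyps by (simp add: upt_conv_Cons)
  consider "target S (row_reading (scell r) r n) a"
    | "passes S (row_reading (scell r) r n) a (Suc a)" "Suc a < n"
    using row_target_or_passes[of r "scell r" n S a] step by auto
  then show ?case
  proof cases
    case 1
    then show ?thesis unfolding split by (rule target_append_right)
  next
    case 2
    have "target S (concat (map (\<lambda>r. row_reading (scell r) r n) [Suc r..<n])) (Suc a)"
      using step 2 by (intro step.IH) auto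
    with 2(1) show ?thesis unfolding split by (rule target_append)
  qed
qed

lemma vertical_split:
  assumes "1 \<le> i" "i < n"
  shows "map (Vert k) [1..<n] = map (Vert k) [1..<i] @ Vert k i # map (Vert k) [Suc i..<n]"
proof -
  have "[1..<n] = [1..<i] @ i # [Suc i..<n]"
    using assms by (metis le_add_diff_inverse less_imp_le upt_add_eq_append upt_conv_Cons)
  then show ?thesis by simp
qed

lemma vertical_target:
  assumes "1 \<le> i" "i < n" "\<And>j. Vert k j \<notin> S"
  shows "target S (map (Vert k) [1..<n]) i"
proof -
  have "subword S (map (Vert k) [1..<i]) = []" using assms(3) by (intro subword_empty) auto
  then show ?thesis unfolding target_def vertical_split[OF assms(1,2)]
    using passes_empty by (intro exI[of _ "map (Vert k) [1..<i]"] exI[of _ "Vert k i"] exI) auto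
qed

text \<open>A letter that does not stop in the horizontal part leaves it as \<open>a + 1\<close> and
  can stop at the vertical box of that index, as the vertical part is empty.\<close>

lemma gamma_target:
  assumes "adjusted (hcell k) 0 n S" "\<And>j. Vert k j \<notin> S" "1 \<le> a" "a < n"
  shows "target S (gamma_reading n k) a"
proof -
  have gamma: "gamma_reading n k = row_reading (hcell k) 0 n @ map (Vert k) [1..<n]"
    using assms by (intro gamma_reading_eq) simp
  consider "target S (row_reading (hcell k) 0 n) a"
    | "passes S (row_reading (hcell k) 0 n) a (Suc a)" "Suc a < n"
    using row_target_or_passes[of 0 "hcell k" n S a] assms by auto
  then show ?thesis
  proof cases
    case 1
    then show ?thesis unfolding gamma by (rule target_append_right)
  next
    case 2
    then show ?thesis unfolding gamma
      using vertical_target[of "Suc a" n k S] assms by (intro target_append) auto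
  qed
qed

text \<open>After an elbow at index \<open>i - 1\<close>, the letters still to be read in the row
  are at most \<open>i - 2\<close>. They commute with \<open>i\<close>, so the letter of the
  offending cross leaves the row unchanged.\<close>

lemma fragment_split:
  assumes index: "\<And>i. r \<le> i \<Longrightarrow> box_index (f i) = i" and "\<not> adjusted f r n S"
  obtains A i Y where "row_reading f r n = A @ f i # Y" "f i \<in> S" "passes S Y i i" "r < i" "i < n"
proof -
  obtain i where i: "r < i" "i < n" "f i \<in> S" "f (i - 1) \<notin> S"
    using assms(2) by (auto simp: adjusted_def)
  have "row_reading f r i = f (i - 1) # row_reading f r (i - 1)"
    using i row_reading_split[of r "i - 1" i f] by simp
  then have sub: "subword S (row_reading f r i) = subword S (row_reading f r (i - 1))"
    using i(4) by simp
  have "passes S (row_reading f r i) i i"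
    unfolding passes_def sub
    by (rule gen_word_commute) (auto simp: set_subword row_reading_def index)
  with i that[OF row_reading_split[of r i n f]] show thesis by simp
qed

lemma reading_suffix: "k \<le> T \<Longrightarrow> \<exists>A. reading n T = A @ reading n k"
proof (induction T rule: dec_induct)
  case (step m)
  then show ?case by (metis append_assoc reading_Suc)
qed simp

section \<open>Moves at the lowest violation of conditions (1) and (2)\<close>

context
  fixes n :: nat and w :: "int \<Rightarrow> int" and D :: "box \<Rightarrow> element" and S :: "box set" and T :: nat
  assumes n: "n \<ge> 1" and w: "w \<in> BC n" and D: "D \<in> PD n w" and S: "S = significant_boxes n D"
    and T: "\<And>c. c \<in> S \<Longrightarrow> block c \<le> T"
begin

text \<open>The offending letter \<open>i\<close> leaves row \<open>r\<close> unchanged; because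
  \<open>r < i\<close> it can enter row \<open>r + 1\<close>, and it stops in one of the
  left-adjusted rows below.\<close>

lemma movable_stair:
  assumes r: "1 \<le> r" "r < n" "\<not> adjusted (scell r) r n S"
    and below: "\<And>r'. r < r' \<Longrightarrow> r' < n \<Longrightarrow> adjusted (scell r') r' n S"
  shows "movable n w D"
proof -
  let ?rows = "\<lambda>is. concat (map (\<lambda>r. row_reading (scell r) r n) is)"
  obtain A i Y where row: "row_reading (scell r) r n = A @ scell r i # Y"
    and i: "scell r i \<in> S" "passes S Y i i" "r < i" "i < n"
    using fragment_split[of r "scell r" n S] r(3) by auto
  have "[1..<n] = [1..<r] @ r # [Suc r..<n]"
    using r by (metis le_add_diff_inverse less_imp_le upt_add_eq_append upt_conv_Cons)
  then have stair: "stair_reading n = ?rows [1..<r] @ (A @ scell r i # Y) @ ?rows [Suc r..<n]"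
    by (simp add: stair_reading_eq row)
  obtain G where "reading n T = G @ stair_reading n"
    using reading_suffix[of 0 T n] by (auto simp: reading_0)
  then have reading: "reading n T = (G @ ?rows [1..<r] @ A) @ scell r i # Y @ ?rows [Suc r..<n] @ []"
    using stair by simp
  show ?thesis
  proof (rule movable_targetI[OF n w D S T reading i(1)])
    show "passes S Y (box_index (scell r i)) i" using i by simp
    show "target S (?rows [Suc r..<n]) i"
      using i r below by (intro stairs_target) auto
    show "row_above (scell r i) b" if "b \<in> set (?rows [Suc r..<n])" for b
      using that by (auto simp: row_above_def row_reading_def)
  qed simp_all
qed

lemma gamma_in_reading:
  assumes "1 \<le> k" "k \<le> T"
  obtains A where "reading n T = A @ gamma_reading n k @ reading n (k - 1)"
  using reading_suffix[OF assms(2), of n] reading_Suc[of n "k - 1"] assms(1) by auto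

text \<open>Nothing is read in the block after its lowest vertical cross. The letter therefore
  leaves the block unchanged and stops in block \<open>k - 1\<close>, or in the staircase if
  \<open>k = 1\<close>.\<close>

lemma movable_vertical:
  assumes k: "1 \<le> k" "Vert k i \<in> S" and last: "\<And>j. i < j \<Longrightarrow> Vert k j \<notin> S"
    and stairs: "\<And>r. 1 \<le> r \<Longrightarrow> r < n \<Longrightarrow> adjusted (scell r) r n S"
    and below: "\<And>k'. 1 \<le> k' \<Longrightarrow> k' < k \<Longrightarrow> adjusted (hcell k') 0 n S \<and> (\<forall>j. Vert k' j \<notin> S)"
  shows "movable n w D"
proof -
  have i: "1 \<le> i" "i < n"
    using k(2) significant_boxes_base[of n D] n unfolding S by (auto simp: base_def)
  obtain A where A: "reading n T = A @ gamma_reading n k @ reading n (k - 1)"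
    using gamma_in_reading[of k] k T by force
  have reading: "reading n T = (A @ row_reading (hcell k) 0 n @ map (Vert k) [1..<i]) @
      Vert k i # map (Vert k) [Suc i..<n] @ reading n (k - 1) @ []"
    unfolding A gamma_reading_eq[OF n] vertical_split[OF i] by simp
  show ?thesis
  proof (rule movable_targetI[OF n w D S T reading k(2)])
    show "passes S (map (Vert k) [Suc i..<n]) (box_index (Vert k i)) i"
      using last by (auto intro!: passes_empty subword_empty)
    show "target S (reading n (k - 1)) i"
    proof (cases "k = 1")
      case True
      then show ?thesis using i stairs
        by (simp only: reading_0 stair_reading_eq diff_self_eq_0) (intro stairs_target, auto)
    next
      case False
      then have "target S (gamma_reading n (k - 1)) i"
        using below[of "k - 1"] k i by (intro gamma_target) auto
      moreover have "reading n (k - 1) = gamma_reading n (k - 1) @ reading n (k - 2)"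
        using reading_Suc[of n "k - 2"] False k(1) by (simp add: numeral_2_eq_2 Suc_diff_Suc)
      ultimately show ?thesis by (simp add: target_append_right)
    qed
    show "row_above (Vert k i) b" if "b \<in> set (reading n (k - 1))" for b
      using that k(1) by (auto simp: set_reading[OF n] row_above_def)
  qed simp_all
qed

text \<open>The offending letter leaves the horizontal part unchanged and goes to the vertical box
  of the same index in the same block.\<close>

lemma movable_horizontal:
  assumes k: "1 \<le> k" "\<not> adjusted (hcell k) 0 n S" and vert: "\<And>j. Vert k j \<notin> S"
  shows "movable n w D"
proof -
  obtain B i Y where row: "row_reading (hcell k) 0 n = B @ hcell k i # Y"
    and i: "hcell k i \<in> S" "passes S Y i i" "0 < i" "i < n"
    using fragment_split[of 0 "hcell k" n S] k(2) by auto
  obtain A where A: "reading n T = A @ gamma_reading n k @ reading n (k - 1)"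
    using gamma_in_reading[of k] k i T by force
  have reading: "reading n T = (A @ B) @ hcell k i # Y @ map (Vert k) [1..<n] @ reading n (k - 1)"
    unfolding A gamma_reading_eq[OF n] row by simp
  show ?thesis
  proof (rule movable_targetI[OF n w D S T reading i(1)])
    show "passes S Y (box_index (hcell k i)) i" using i by simp
    show "target S (map (Vert k) [1..<n]) i"
      using i vert by (intro vertical_target) auto
  qed (use i in \<open>auto simp: row_above_def\<close>)
qed

text \<open>If \<open>m \<le> 1\<close>, no letter is read between the corners of blocks
  \<open>k + 1\<close> and \<open>k\<close>, and the faucet drops to the lower corner. Otherwise the
  relation for two equal runs moves the cross of index \<open>m - 1\<close> from block
  \<open>k + 1\<close> to the first vertical box of block \<open>k\<close>.\<close>

lemma movable_counts:
  assumes k: "1 \<le> k" and vert: "\<And>k j. Vert k j \<notin> S"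
    and m: "\<And>i. i < n \<Longrightarrow> hcell k i \<in> S \<longleftrightarrow> i < m" "m \<le> m'" "m' \<le> n" "0 < m'"
    and m': "\<And>i. i < n \<Longrightarrow> hcell (Suc k) i \<in> S \<longleftrightarrow> i < m'"
  shows "movable n w D"
proof -
  have "hcell (Suc k) 0 \<in> S" using m' m n by simp
  then have "Suc k \<le> T" using T by force
  then obtain A where "reading n T = A @ gamma_reading n (Suc k) @ reading n k"
    using gamma_in_reading[of "Suc k"] by auto
  moreover have "reading n k = gamma_reading n k @ reading n (k - 1)"
    using reading_Suc[of n "k - 1"] k by simp
  ultimately have reading: "reading n T = A @ row_reading (hcell (Suc k)) 0 n @ map (Vert (Suc k)) [1..<n] @
      row_reading (hcell k) 0 n @ map (Vert k) [1..<n] @ reading n (k - 1)"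
    by (simp add: gamma_reading_eq[OF n])
  have sub_vert: "subword S (map (Vert (Suc k)) [1..<n]) = []"
    using vert by (intro subword_empty) auto
  show ?thesis
  proof (cases "m \<le> 1")
    case True
    let ?B = "map (Vert (Suc k)) [1..<n] @ map (hcell k) (rev [1..<n])"
    have split: "row_reading (hcell j) 0 n = map (hcell j) (rev [1..<n]) @ [hcell j 0]" for j
      using row_reading_split[of 0 0 n "hcell j"] n by (simp add: row_reading_def)
    have reading': "reading n T = (A @ map (hcell (Suc k)) (rev [1..<n])) @ hcell (Suc k) 0 # ?B @ hcell k 0 #
        map (Vert k) [1..<n] @ reading n (k - 1)"
      unfolding reading split by simp
    show ?thesis
    proof (rule movableI[OF n w D S T reading'])
      have "subword S (map (hcell k) (rev [1..<n])) = []"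
        using m True by (intro subword_empty) auto
      then show "word_prod (box_index (hcell (Suc k) 0) # subword S ?B) =
          word_prod (subword S ?B @ [box_index (hcell k 0)])"
        unfolding subword_append sub_vert by simp
    qed (use \<open>hcell (Suc k) 0 \<in> S\<close> in \<open>auto simp: row_above_def\<close>)
  next
    case False
    \<comment> \<open>The shift by 2 fits \<open>gen_double_descending\<close>: the run
      \<open>m - 1, ..., 0\<close> of block \<open>k + 1\<close> equals the run of block
      \<open>k\<close>, and the larger letters of block \<open>k + 1\<close> are read before it and
      stay in place.\<close>
    define l where "l = m - 2"
    have l: "m = Suc (Suc l)" using False by (simp add: l_def)
    let ?B = "row_reading (hcell (Suc k)) 0 (Suc l) @ map (Vert (Suc k)) [1..<n] @ row_reading (hcell k) 0 n"
    have row: "row_reading (hcell (Suc k)) 0 n =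
        map (hcell (Suc k)) (rev [m..<n]) @ hcell (Suc k) (Suc l) # row_reading (hcell (Suc k)) 0 (Suc l)"
      using row_reading_split[of 0 "Suc l" n "hcell (Suc k)"] l m by simp
    have "map (Vert k) [1..<n] = Vert k 1 # map (Vert k) [2..<n]"
      using vertical_split[of 1 n k] l m by (simp add: numeral_2_eq_2)
    then have reading': "reading n T = (A @ map (hcell (Suc k)) (rev [m..<n])) @ hcell (Suc k) (Suc l) # ?B @
        Vert k 1 # map (Vert k) [2..<n] @ reading n (k - 1)"
      unfolding reading row by simp
    show ?thesis
    proof (rule movableI[OF n w D S T reading'])
      have "subword S (row_reading (hcell k) 0 n) = rev [0..<m]"
        using m by (intro subword_row) auto
      moreover have "subword S (row_reading (hcell (Suc k)) 0 (Suc l)) = rev [0..<Suc l]"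
        using m m' l by (intro subword_row) auto
      ultimately have B: "subword S ?B = rev [0..<Suc l] @ rev [0..<Suc (Suc l)]"
        unfolding subword_append sub_vert l by simp
      show "word_prod (box_index (hcell (Suc k) (Suc l)) # subword S ?B) =
          word_prod (subword S ?B @ [box_index (Vert k 1)])"
        using gen_double_descending[of l] unfolding B by simp
    qed (use m m' l in \<open>auto simp: row_above_def\<close>)
  qed
qed

end

section \<open>Pipe dreams that admit no further descent satisfy (1) and (2)\<close>

lemma no_elbow_cross_iff:
  assumes n: "n \<ge> 1" and D: "D \<in> pipe_dreams n" and S: "S = significant_boxes n D"
  shows "no_elbow_cross n D \<longleftrightarrow>
    (\<forall>r. 1 \<le> r \<and> r < n \<longrightarrow> adjusted (scell r) r n S) \<and>
    (\<forall>k\<ge>1. adjusted (hcell k) 0 n S) \<and> (\<forall>k i. Vert k i \<notin> S)"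
proof
  assume no: "no_elbow_cross n D"
  have frag: "left_content D b \<notin> {Some Double_Elbow, Some Single_Elbow}" if "b \<in> S" "\<not> is_corner b" for b
    using that no pipe_dream_cases(3)[OF D, of b] significant_boxes_base[of n D]
    unfolding S no_elbow_cross_def by blast
  show "(\<forall>r. 1 \<le> r \<and> r < n \<longrightarrow> adjusted (scell r) r n S) \<and>
    (\<forall>k\<ge>1. adjusted (hcell k) 0 n S) \<and> (\<forall>k i. Vert k i \<notin> S)"
  proof (intro conjI allI impI)
    fix r assume r: "1 \<le> r \<and> r < n"
    show "adjusted (scell r) r n S"
      unfolding adjusted_def
    proof (intro allI impI, elim conjE)
      fix i assume i: "r < i" "i < n" "scell r i \<in> S"
      have "scell r (i - 1) \<in> base n" using i r by (auto simp: scell_def base_def)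
      moreover have "left_content D (scell r i) = Some (D (scell r (i - 1)))"
        using i by (auto simp: scell_def Suc_diff_le)
      ultimately show "scell r (i - 1) \<in> S"
        using frag[OF i(3)] pipe_dream_cases(4)[OF D, of "scell r (i - 1)"] unfolding S by auto
    qed
  next
    fix k :: nat assume k: "1 \<le> k"
    show "adjusted (hcell k) 0 n S"
      unfolding adjusted_def
    proof (intro allI impI, elim conjE)
      fix i assume i: "0 < i" "i < n" "hcell k i \<in> S"
      have "hcell k (i - 1) \<in> base n" using i k by (auto simp: hcell_def base_def)
      moreover have "left_content D (hcell k i) = Some (D (hcell k (i - 1)))"
        using i by (auto simp: hcell_def)
      ultimately show "hcell k (i - 1) \<in> S"
        using frag[OF i(3)] i pipe_dream_cases(2,4)[OF D, of "hcell k (i - 1)"] unfolding S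
        by (cases "i = 1") auto
    qed
  next
    fix k i show "Vert k i \<notin> S" using frag[of "Vert k i"] by auto
  qed
next
  assume adj: "(\<forall>r. 1 \<le> r \<and> r < n \<longrightarrow> adjusted (scell r) r n S) \<and>
    (\<forall>k\<ge>1. adjusted (hcell k) 0 n S) \<and> (\<forall>k i. Vert k i \<notin> S)"
  show "no_elbow_cross n D"
    unfolding no_elbow_cross_def
  proof (intro notI, elim bexE conjE)
    fix b assume b: "b \<in> base n" "D b = Cross" "left_content D b \<in> {Some Double_Elbow, Some Single_Elbow}"
    then have bS: "b \<in> S" by (simp add: S significant_boxes_def)
    show False
    proof (cases b)
      case (Stair r j)
      then have r: "1 \<le> r" "r < n" "2 \<le> j" "j \<le> n - r"
        using b n by (auto simp: base_def split: if_splits)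
      \<comment> \<open>Column \<open>j\<close> of row \<open>r\<close> has index
        \<open>r + j - 1\<close>, and its left neighbour has the index one less.\<close>
      have index: "r + j - 1 + 1 - r = j" "r + j - 1 - 1 + 1 - r = j - 1" "(2 \<le> j) = True"
        using r by auto
      have "b = scell r (r + j - 1)" "left_content D b = Some (D (scell r (r + j - 1 - 1)))"
        using Stair index by (simp_all only: scell_def left_content.simps if_True)
      moreover have "adjusted (scell r) r n S" "r < r + j - 1" "r + j - 1 < n" using adj r by auto
      ultimately have "scell r (r + j - 1 - 1) \<in> S" "left_content D b = Some (D (scell r (r + j - 1 - 1)))"
        using r bS unfolding adjusted_def by (blast, blast)
      then show False using b(3) by (auto simp: S significant_boxes_def)
    next
      case (Corner k)
      then show False using b by simp
    next
      case (Horiz k i)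
      then have i: "1 \<le> k" "0 < i" "i < n"
        using b n by (auto simp: base_def)
      then have "b = hcell k i" "left_content D b = Some (D (hcell k (i - 1)))"
        using Horiz by (auto simp: hcell_def)
      moreover have "adjusted (hcell k) 0 n S" using adj i by simp
      ultimately have "hcell k (i - 1) \<in> S" "left_content D b = Some (D (hcell k (i - 1)))"
        using i bS unfolding adjusted_def by auto
      then show False using b(3) by (auto simp: S significant_boxes_def)
    next
      case (Vert k i)
      then show False using adj bS by blast
    qed
  qed
qed

text \<open>With an empty vertical part, all significant elements of the block form the initial
  segment of its horizontal part, whose length is thus the count.\<close>

lemma hcell_significant_iff:
  assumes "n \<ge> 1" "S = significant_boxes n D" "1 \<le> k"
    and "adjusted (hcell k) 0 n S" "\<And>i. Vert k i \<notin> S"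
  shows "gamma_count n D k \<le> n" "i < n \<Longrightarrow> hcell k i \<in> S \<longleftrightarrow> i < gamma_count n D k"
proof -
  obtain m where m: "m \<le> n" "\<And>i. i < n \<Longrightarrow> hcell k i \<in> S \<longleftrightarrow> i < m"
    using adjusted_initial_segment[OF assms(4)] by auto
  have "{b \<in> S. block b = k} = hcell k ` {0..<m}"
  proof
    show "hcell k ` {0..<m} \<subseteq> {b \<in> S. block b = k}" using m by auto
    show "{b \<in> S. block b = k} \<subseteq> hcell k ` {0..<m}"
    proof clarify
      fix b assume b: "b \<in> S" "k = block b"
      have "b \<in> set (gamma_reading n k)"
        using b assms significant_boxes_base[of n D] by (subst set_gamma_reading) auto
      then have "\<exists>i<n. b = hcell k i"
        using b(1) assms(5)
        unfolding gamma_reading_eq[OF assms(1)] row_reading_def by fastforce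
      then obtain i where i: "i < n" "b = hcell k i" by blast
      then have "i < m" using m(2) b(1) by blast
      with i(2) show "b \<in> hcell (block b) ` {0..<m}" by simp
    qed
  qed
  moreover have "card (hcell k ` {0..<m}) = m" by (subst card_image) (auto simp: inj_on_def)
  ultimately have "gamma_count n D k = m" by (simp add: gamma_count_def assms(2))
  with m show "gamma_count n D k \<le> n" "i < n \<Longrightarrow> hcell k i \<in> S \<longleftrightarrow> i < gamma_count n D k" by auto
qed

text \<open>A zero count forces all later ones to vanish. Hence up to the least \<open>r\<close>
  beyond which everything vanishes the counts are positive, and comparing neighbours
  suffices.\<close>

lemma decreasing_countsI:
  assumes "\<And>k. 1 \<le> k \<Longrightarrow> gamma_count n D (Suc k) < gamma_count n D k \<or> gamma_count n D (Suc k) = 0"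
    and "\<And>k. k > T \<Longrightarrow> gamma_count n D k = 0"
  shows "decreasing_counts n D"
proof -
  define r where "r = (LEAST r. \<forall>k>r. gamma_count n D k = 0)"
  have r0: "\<forall>k>r. gamma_count n D k = 0"
    unfolding r_def by (rule LeastI[of _ T]) (use assms(2) in auto)
  have pos: "gamma_count n D k > 0" if "1 \<le> k" "k \<le> r" for k
  proof (rule ccontr)
    assume k: "\<not> gamma_count n D k > 0"
    have "gamma_count n D j = 0" if "j \<ge> k" for j
      using that
    proof (induction j rule: dec_induct)
      case (step j)
      then show ?case using assms(1)[of j] \<open>1 \<le> k\<close> by simp
    qed (use k in simp)
    then have "r \<le> k - 1" unfolding r_def by (intro Least_le) auto
    with that show False by simp
  qed
  have "gamma_count n D k < gamma_count n D j" if "1 \<le> j" "j < k" "k \<le> r" for j k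
    using that
  proof (induction k)
    case (Suc k)
    have "gamma_count n D (Suc k) < gamma_count n D k"
      using assms(1)[of k] pos[of "Suc k"] Suc.prems by simp
    then show ?case using Suc by (cases "j = k") auto
  qed simp
  then show ?thesis using r0 unfolding decreasing_counts_def by blast
qed

text \<open>The absence of a descending move is exploited from the bottom upwards: first the
  staircase rows, then the blocks in increasing order, in each the vertical part before the
  horizontal one, and finally the counts. At each stage everything that the required move passes
  through is already in order.\<close>

lemma movable_or_bottom:
  assumes n: "n \<ge> 1" and w: "w \<in> BC n" and D: "D \<in> PD n w"
  shows "movable n w D \<or> no_elbow_cross n D \<and> decreasing_counts n D"
proof (rule disj_imp[THEN iffD2], rule impI)
  assume stuck: "\<not> movable n w D"
  define S where "S = significant_boxes n D"
  have Dp: "D \<in> pipe_dreams n" using D by (simp add: PD_def)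
  then have "finite (block ` S)" by (simp add: pipe_dreams_def S_def)
  then obtain T where T: "\<And>c. c \<in> S \<Longrightarrow> block c \<le> T"
    by (meson Max_ge imageI)
  note context_facts = n w D S_def T
  have stairs: "adjusted (scell r) r n S" if "1 \<le> r" "r < n" for r
    using less_imp_le[OF that(2)] that
  proof (induction "n - r" arbitrary: r rule: less_induct)
    case less
    then show ?case
      using movable_stair[OF context_facts, of r] stuck by (meson diff_less_mono2 le_trans less_imp_le)
  qed
  have gammas: "adjusted (hcell k) 0 n S \<and> (\<forall>j. Vert k j \<notin> S)" if "1 \<le> k" for k
    using that
  proof (induction k rule: less_induct)
    case (less k)
    have "\<forall>j. Vert k j \<notin> S"
    proof (rule ccontr)
      \<comment> \<open>The largest index in \<open>V\<close> is the lowest vertical cross of the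
        block.\<close>
      define V where "V = {j. Vert k j \<in> S}"
      assume "\<not> (\<forall>j. Vert k j \<notin> S)"
      then have "V \<noteq> {}" by (simp add: V_def)
      moreover have "j < n" if "Vert k j \<in> S" for j
        using that significant_boxes_base[of n D] n by (auto simp: S_def base_def)
      then have "V \<subseteq> {..<n}" by (auto simp: V_def)
      then have fin: "finite V" using finite_subset by blast
      ultimately have "Max V \<in> V" by (intro Max_in)
      then have "Vert k (Max V) \<in> S" by (simp add: V_def)
      moreover have "Vert k j \<notin> S" if "Max V < j" for j
      proof
        assume "Vert k j \<in> S"
        then have "j \<le> Max V" using fin by (intro Max_ge) (simp_all add: V_def)
        with that show False by simp
      qed
      moreover have "adjusted (hcell k') 0 n S \<and> (\<forall>j. Vert k' j \<notin> S)" if "1 \<le> k'" "k' < k" for k'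
        using less.IH that by blast
      ultimately have "movable n w D"
        using stairs by (intro movable_vertical[OF context_facts less.prems])
      with stuck show False ..
    qed
    then show ?case
      using movable_horizontal[OF context_facts less.prems] stuck by blast
  qed
  have vert: "Vert k j \<notin> S" for k j
    using gammas[of k] significant_boxes_base[of n D] by (cases "k \<ge> 1") (auto simp: S_def base_def)
  have no: "no_elbow_cross n D"
    using no_elbow_cross_iff[OF n Dp S_def] stairs gammas vert by blast
  have count: "gamma_count n D k \<le> n"
    "\<And>i. i < n \<Longrightarrow> hcell k i \<in> S \<longleftrightarrow> i < gamma_count n D k" if "1 \<le> k" for k
    using hcell_significant_iff[OF n S_def that] gammas[OF that] vert by auto
  have "decreasing_counts n D"
  proof (rule decreasing_countsI)
    fix k :: nat assume k: "1 \<le> k"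
    show "gamma_count n D (Suc k) < gamma_count n D k \<or> gamma_count n D (Suc k) = 0"
      using movable_counts[OF context_facts k vert count(2)[OF k] _ count(1)[of "Suc k"] _ count(2)[of "Suc k"]]
        stuck by (meson le_SucI k not_less gr0I)
  next
    fix k assume "k > T"
    then have "{b \<in> S. block b = k} = {}" using T by force
    then show "gamma_count n D k = 0" unfolding gamma_count_def S_def by (simp only: card.empty)
  qed
  with no show "no_elbow_cross n D \<and> decreasing_counts n D" ..
qed

section \<open>The signed Lehmer code of a bottom pipe dream\<close>

text \<open>On positive numbers the run is a cycle, and each further letter \<open>e\<close> on the
  left exchanges \<open>e\<close> and \<open>e + 1\<close>, lengthening the cycle by one.\<close>

lemma word_prod_descending:
  assumes "1 \<le> r" "r \<le> e" "x > 0"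
  shows "word_prod (rev [r..<e]) x =
    (if x = int r then int e else if int r < x \<and> x \<le> int e then x - 1 else x)"
  using assms(2)
proof (induction e rule: dec_induct)
  case base
  then show ?case by auto
next
  case (step e)
  then show ?case using assms by (simp add: gen_pos)
qed

text \<open>The letter 0 acts first and changes only 1 into -1, which the rest of the run, an odd
  map, takes to \<open>- m\<close>.\<close>

lemma word_prod_descending_0:
  assumes "1 \<le> m" "x > 0"
  shows "word_prod (rev [0..<m]) x = (if x = 1 then - int m else if x \<le> int m then x - 1 else x)"
proof -
  have "[0..<m] = 0 # [1..<m]" using assms by (simp add: upt_conv_Cons)
  then have split: "word_prod (rev [0..<m]) x = word_prod (rev [1..<m]) (gen 0 x)"
    by simp
  show ?thesis
  proof (cases "x = 1")
    case True
    then have "word_prod (rev [0..<m]) x = word_prod (rev [1..<m]) (- 1)"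
      by (subst split) (simp add: gen_0)
    also have "\<dots> = - int m"
      using word_prod_uminus[of "rev [1..<m]" 1] word_prod_descending[of 1 m 1] assms by simp
    finally show ?thesis using True by simp
  next
    case False
    then have "gen 0 x = x" using assms by (simp add: gen_0)
    then show ?thesis unfolding split
      using word_prod_descending[of 1 m x] assms False by simp
  qed
qed

lemma inj_word_prod: "inj (word_prod u)"
proof (rule inj_on_inverseI)
  fix x show "word_prod (rev u) (word_prod u x) = x"
    using fun_cong[OF word_prod_rev, of u x] by simp
qed

text \<open>The code depends only on the relative order of the values, and \<open>g\<close>
  preserves it.\<close>

lemma code_L_strict_mono:
  assumes "\<And>j. i \<le> j \<Longrightarrow> j \<le> n \<Longrightarrow> p (int j) \<in> A" "strict_mono_on A g" "i \<le> n"
  shows "code_L n (g \<circ> p) i = code_L n p i"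
proof -
  have "g (p (int i)) > g (p (int j)) \<longleftrightarrow> p (int i) > p (int j)" if "i < j" "j \<le> n" for j
    using assms(1)[of i] assms(1)[of j] that strict_mono_on_less[OF assms(2)] by simp
  then show ?thesis
    unfolding code_L_def comp_apply by (intro arg_cong[of _ _ card]) blast
qed

text \<open>Induction from the bottom row: the lower rows give \<open>q\<close>, which fixes
  \<open>r\<close> and permutes the larger numbers, and row \<open>r\<close> composes it with a
  cycle \<open>g\<close>. As \<open>g\<close> is increasing above \<open>r\<close>, the later code
  entries persist. As \<open>r\<close> goes to \<open>e r\<close>, the smaller values at later
  positions are exactly \<open>r, ..., e r - 1\<close>.\<close>

lemma staircase_word:
  assumes e: "\<And>r. 1 \<le> r \<Longrightarrow> r < n \<Longrightarrow> r \<le> e r \<and> e r \<le> n"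
    and r: "r \<le> n" "1 \<le> r"
    and p: "p = word_prod (concat (map (\<lambda>r. rev [r..<e r]) [r..<n]))"
  shows "\<And>x. 0 < x \<Longrightarrow> x < int r \<Longrightarrow> p x = x"
    and "bij_betw p {int r..int n} {int r..int n}"
    and "\<And>i. r \<le> i \<Longrightarrow> i < n \<Longrightarrow> code_L n p i = e i - i"
proof -
  have "(\<forall>x. 0 < x \<and> x < int r \<longrightarrow> p x = x) \<and> p ` {int r..int n} \<subseteq> {int r..int n} \<and>
    bij_betw p {int r..int n} {int r..int n} \<and> (\<forall>i. r \<le> i \<and> i < n \<longrightarrow> code_L n p i = e i - i)"
    using r p
  proof (induction r arbitrary: p rule: inc_induct)
    case base
    then show ?case by (auto simp: bij_betw_def)
  next
    case (step r)
    define q where "q = word_prod (concat (map (\<lambda>r. rev [r..<e r]) [Suc r..<n]))"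
    define g where "g = word_prod (rev [r..<e r])"
    have r: "1 \<le> r" "r < n" and er: "r \<le> e r" "e r \<le> n" using step e[of r] by auto
    have p: "p = g \<circ> q" using step.hyps unfolding step.prems q_def g_def by (simp add: upt_conv_Cons)
    have q: "\<And>x. 0 < x \<Longrightarrow> x < int (Suc r) \<Longrightarrow> q x = x"
      "q ` {int (Suc r)..int n} \<subseteq> {int (Suc r)..int n}"
      "\<And>i. Suc r \<le> i \<Longrightarrow> i < n \<Longrightarrow> code_L n q i = e i - i"
      using step.IH[OF _ q_def] by auto
    have g: "g x = (if x = int r then int (e r) else if int r < x \<and> x \<le> int (e r) then x - 1 else x)"
      if "x > 0" for x
      using word_prod_descending[OF r(1) er(1) that] by (simp add: g_def)
    have fixed: "p x = x" if "0 < x" "x < int r" for x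
      using that q(1)[of x] g[of x] by (simp add: p)
    have pr: "p (int r) = int (e r)"
      using q(1)[of "int r"] g[of "int r"] r by (simp add: p)
    have into: "p ` {int r..int n} \<subseteq> {int r..int n}"
    proof clarify
      fix x assume x: "x \<in> {int r..int n}"
      show "p x \<in> {int r..int n}"
      proof (cases "x = int r")
        case True
        then show ?thesis using pr er by simp
      next
        case False
        then have "x \<in> {int (Suc r)..int n}" using x by simp
        then have "q x \<in> {int (Suc r)..int n}" using q(2) by blast
        then show ?thesis using g[of "q x"] by (simp add: p)
      qed
    qed
    have inj: "inj p" using inj_word_prod unfolding step.prems .
    \<comment> \<open>An injective map of a finite interval into itself is onto.\<close>
    have bij: "bij_betw p {int r..int n} {int r..int n}"
      using endo_inj_surj[OF _ into inj_on_subset[OF inj]] inj_on_subset[OF inj]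
      by (simp add: bij_betw_def)
    have "code_L n p i = e i - i" if i: "r \<le> i" "i < n" for i
    proof (cases "i = r")
      case True
      let ?J = "{j. r < j \<and> j \<le> n \<and> p (int r) > p (int j)}"
      have "(\<lambda>j. p (int j)) ` ?J = {int r..<int (e r)}"
      proof
        show "(\<lambda>j. p (int j)) ` ?J \<subseteq> {int r..<int (e r)}"
        proof clarify
          fix j assume "r < j" "j \<le> n" "p (int j) < p (int r)"
          moreover from this have "p (int j) \<in> {int r..int n}" by (intro subsetD[OF into imageI]) simp
          ultimately show "p (int j) \<in> {int r..<int (e r)}" using pr by simp
        qed
        show "{int r..<int (e r)} \<subseteq> (\<lambda>j. p (int j)) ` ?J"
        proof
          fix y assume y: "y \<in> {int r..<int (e r)}"
          then have "y \<in> p ` {int r..int n}" using bij er by (simp add: bij_betw_def)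
          then obtain x where x: "x \<in> {int r..int n}" "y = p x" by blast
          then have "x \<noteq> int r" using y pr by auto
          then have "nat x \<in> ?J" "y = p (int (nat x))" using x y pr by auto
          then show "y \<in> (\<lambda>j. p (int j)) ` ?J" by blast
        qed
      qed
      moreover have "inj_on (\<lambda>j. p (int j)) ?J"
        by (rule inj_onI) (metis injD[OF inj] of_nat_eq_iff)
      ultimately have "card ?J = card {int r..<int (e r)}" using card_image by fastforce
      then show ?thesis using True by (simp add: code_L_def)
    next
      case False
      have "strict_mono_on {int (Suc r)..int n} g"
        by (rule strict_mono_onI) (auto simp: g)
      moreover have "q (int j) \<in> {int (Suc r)..int n}" if "i \<le> j" "j \<le> n" for j
        using that i False by (intro subsetD[OF q(2) imageI]) simp
      ultimately have "code_L n p i = code_L n q i"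
        unfolding p using i by (intro code_L_strict_mono) auto
      then show ?thesis using q(3)[of i] i False by simp
    qed
    then show ?case using fixed into bij by blast
  qed
  then show "\<And>x. 0 < x \<Longrightarrow> x < int r \<Longrightarrow> p x = x" "bij_betw p {int r..int n} {int r..int n}"
    "\<And>i. r \<le> i \<Longrightarrow> i < n \<Longrightarrow> code_L n p i = e i - i"
    by blast+
qed

text \<open>A new block acts on the values produced by the blocks below it. Its run changes only
  values of absolute value at most \<open>m (t + 1)\<close>, so the earlier values
  \<open>- m i\<close> stay, while the value 1, found at position \<open>t + 1\<close>, becomes
  \<open>- m (t + 1)\<close>.\<close>

lemma gamma_blocks_word:
  assumes m: "\<And>j k. 1 \<le> j \<Longrightarrow> j < k \<Longrightarrow> k \<le> s \<Longrightarrow> m k < m j" "\<And>k. 1 \<le> k \<Longrightarrow> k \<le> s \<Longrightarrow> 1 \<le> m k"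
    and t: "t \<le> s" and q: "q = word_prod (concat (map (\<lambda>k. rev [0..<m k]) (rev [1..<Suc t])))"
  shows "\<And>i. 1 \<le> i \<Longrightarrow> i \<le> t \<Longrightarrow> q (int i) = - int (m i)"
    and "\<And>x. int t < x \<Longrightarrow> 0 < q x"
    and "strict_mono_on {0<..} q"
proof -
  \<comment> \<open>The second conjunct is an extra invariant: from position \<open>t + 1\<close>
    on, the values are 1, 2, ... as long as they stay below \<open>m t\<close>. This is why the next
    run meets the value 1 at position \<open>t + 1\<close>.\<close>
  have "(\<forall>i. 1 \<le> i \<and> i \<le> t \<longrightarrow> q (int i) = - int (m i)) \<and>
    (\<forall>x. 0 < x \<and> (1 \<le> t \<longrightarrow> x < int (m t)) \<longrightarrow> q (int t + x) = x) \<and>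
    (\<forall>x. int t < x \<longrightarrow> 0 < q x) \<and> strict_mono_on {0<..} q"
    using t q
  proof (induction t arbitrary: q)
    case 0
    then show ?case by (auto simp: strict_mono_on_def)
  next
    case (Suc t)
    define q' where "q' = word_prod (concat (map (\<lambda>k. rev [0..<m k]) (rev [1..<Suc t])))"
    define g where "g = word_prod (rev [0..<m (Suc t)])"
    define M where "M = int (m (Suc t))"
    have q: "q = g \<circ> q'" unfolding Suc.prems q'_def g_def by simp
    have IH: "\<And>i. 1 \<le> i \<Longrightarrow> i \<le> t \<Longrightarrow> q' (int i) = - int (m i)"
      "\<And>x. 0 < x \<Longrightarrow> (1 \<le> t \<Longrightarrow> x < int (m t)) \<Longrightarrow> q' (int t + x) = x"
      "\<And>x. int t < x \<Longrightarrow> 0 < q' x" "strict_mono_on {0<..} q'"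
      using Suc.IH[OF _ q'_def] Suc.prems(1) by auto
    have M: "1 \<le> M" "M < int (m i)" if "1 \<le> i" "i \<le> t" for i
      using m(1)[of i "Suc t"] m(2)[of "Suc t"] that Suc.prems(1) by (auto simp: M_def)
    have M1: "1 \<le> M" using m(2)[of "Suc t"] Suc.prems(1) by (simp add: M_def)
    have g: "g x = (if x = 1 then - M else if x \<le> M then x - 1 else x)" if "x > 0" for x
      using word_prod_descending_0[OF _ that, of "m (Suc t)"] M1 by (simp add: g_def M_def)
    have g_neg: "g x = x" if "x < - M" for x
      using word_prod_uminus[of "rev [0..<m (Suc t)]" "- x"] g[of "- x"] that M1
      by (simp add: g_def)
    have old: "q (int i) = - int (m i)" if "1 \<le> i" "i \<le> t" for i
      using IH(1)[OF that] g_neg[of "- int (m i)"] M(2)[OF that] by (simp add: q)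
    have one: "q' (int t + 1) = 1"
      using M[of t] by (intro IH(2)) auto
    have new: "q (int (Suc t)) = - M"
      using one g[of 1] by (simp add: q add.commute)
    have above: "q' x > 1" if "int (Suc t) < x" for x
      using strict_mono_onD[OF IH(4), of "int t + 1" x] that one by simp
    have pos: "0 < q x" if "int (Suc t) < x" for x
      using above[OF that] g[of "q' x"] M1 by (simp add: q)
    have shift: "q (int (Suc t) + x) = x" if "0 < x" "x < M" for x
    proof -
      have "q' (int t + (x + 1)) = x + 1"
        using that M[of t] by (intro IH(2)) auto
      then show ?thesis using g[of "x + 1"] that by (simp add: q algebra_simps)
    qed
    have low: "q x = q' x" "q' x < - M" if "0 < x" "x \<le> int t" for x
      using that old[of "nat x"] IH(1)[of "nat x"] M(2)[of "nat x"] by auto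
    have "strict_mono_on {0<..} q"
    proof (rule strict_mono_onI)
      fix x y :: int assume xy: "x \<in> {0<..}" "x < y"
      then have less: "q' x < q' y" using strict_mono_onD[OF IH(4)] by simp
      \<comment> \<open>Position \<open>t + 1\<close>, whose value is now \<open>- M\<close>,
        belongs to the positions beyond \<open>t\<close>: its value exceeds the older negative ones
        and is below the positive ones. On positive numbers \<open>g\<close> itself is
        increasing.\<close>
      consider "y \<le> int t" | "x \<le> int t" "int t < y" | "int t < x" by linarith
      then show "q x < q y"
      proof cases
        case 1
        then show ?thesis using low[of x] low[of y] xy less by simp
      next
        case 2
        then show ?thesis using low[of x] xy IH(3)[of y] g[of "q' y"] M1 by (simp add: q)
      next
        case 3
        then show ?thesis using IH(3)[of x] IH(3)[of y] g[of "q' x"] g[of "q' y"] xy less M1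
          by (auto simp: q)
      qed
    qed
    moreover have "q (int i) = - int (m i)" if "1 \<le> i" "i \<le> Suc t" for i
      using old[of i] new that by (cases "i = Suc t") (auto simp: M_def)
    ultimately show ?case using pos shift by (auto simp: M_def)
  qed
  then show "\<And>i. 1 \<le> i \<Longrightarrow> i \<le> t \<Longrightarrow> q (int i) = - int (m i)" "\<And>x. int t < x \<Longrightarrow> 0 < q x"
    "strict_mono_on {0<..} q"
    by blast+
qed

text \<open>In the factorization \<open>w = q \<circ> p\<close> the blocks give \<open>q\<close>,
  increasing on positive numbers, so the code of \<open>w\<close> is that of \<open>p\<close>. Since
  \<open>p\<close> permutes \<open>1, ..., n\<close>, the negative values of \<open>w\<close> at
  positive arguments are those of \<open>q\<close>, namely \<open>- m 1, ..., - m s\<close>.\<close>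

lemma codes_of_word:
  assumes w: "w \<in> BC n" "w = word_prod (concat (map (\<lambda>k. rev [0..<m k]) (rev [1..<Suc s])) @
      concat (map (\<lambda>r. rev [r..<e r]) [1..<n]))"
    and n: "1 \<le> n"
    and e: "\<And>r. 1 \<le> r \<Longrightarrow> r < n \<Longrightarrow> r \<le> e r \<and> e r \<le> n"
    and m: "\<And>j k. 1 \<le> j \<Longrightarrow> j < k \<Longrightarrow> k \<le> s \<Longrightarrow> m k < m j" "\<And>k. 1 \<le> k \<Longrightarrow> k \<le> s \<Longrightarrow> 1 \<le> m k"
      "\<And>k. 1 \<le> k \<Longrightarrow> k \<le> s \<Longrightarrow> m k \<le> n"
  shows "\<And>i. 1 \<le> i \<Longrightarrow> i < n \<Longrightarrow> code_L n w i = e i - i"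
    and "num_neg n w = s"
    and "\<And>j. 1 \<le> j \<Longrightarrow> j \<le> s \<Longrightarrow> code_N n w j = m j"
proof -
  define q where "q = word_prod (concat (map (\<lambda>k. rev [0..<m k]) (rev [1..<Suc s])))"
  define p where "p = word_prod (concat (map (\<lambda>r. rev [r..<e r]) [1..<n]))"
  have wqp: "w = q \<circ> p" using w(2) by (simp add: q_def p_def)
  have q: "\<And>i. 1 \<le> i \<Longrightarrow> i \<le> s \<Longrightarrow> q (int i) = - int (m i)"
    "\<And>x. int s < x \<Longrightarrow> 0 < q x" "strict_mono_on {0<..} q"
    using gamma_blocks_word[of s m s q] m(1,2) q_def by blast+
  have p: "bij_betw p {1..int n} {1..int n}" "\<And>i. 1 \<le> i \<Longrightarrow> i < n \<Longrightarrow> code_L n p i = e i - i"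
    using staircase_word(2,3)[OF e n order.refl p_def] by auto
  have p_in: "p x \<in> {1..int n}" if "x \<in> {1..int n}" for x
    using p(1) that by (auto simp: bij_betw_def)
  have q_neg: "q x < 0 \<longleftrightarrow> x \<le> int s" if "0 < x" for x
  proof (cases "x \<le> int s")
    case True
    then have "1 \<le> nat x" "nat x \<le> s" using that by auto
    then show ?thesis using q(1)[of "nat x"] m(2)[of "nat x"] that True by simp
  next
    case False
    then show ?thesis using q(2)[of x] by simp
  qed
  \<comment> \<open>The counts start at most at \<open>n\<close> and drop by at least one each time;
    with \<open>1 \<le> m s\<close> this yields \<open>s \<le> n\<close>, so that
    \<open>1, ..., s\<close> are all values of \<open>p\<close>.\<close>
  have bound: "m k + k \<le> n + 1" if "1 \<le> k" "k \<le> s" for k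
    using that
  proof (induction k rule: dec_induct)
    case base
    then show ?case using m(3) by simp
  next
    case (step k)
    then show ?case using m(1)[of k "Suc k"] by simp
  qed
  have s: "s \<le> n" using m(2)[of s] bound[of s] by (cases "s = 0") auto
  show "code_L n w i = e i - i" if "1 \<le> i" "i < n" for i
  proof -
    have "p (int j) \<in> {0<..}" if "i \<le> j" "j \<le> n" for j
      using p_in[of "int j"] that \<open>1 \<le> i\<close> by simp
    then have "code_L n w i = code_L n p i"
      unfolding wqp using that by (intro code_L_strict_mono[OF _ q(3)]) auto
    then show ?thesis using p(2)[OF that] by simp
  qed
  show "num_neg n w = s"
  proof -
    let ?I = "{i \<in> {1..n}. w (int i) < 0}"
    have "(\<lambda>i. p (int i)) ` ?I = {1..int s}"
    proof
      show "(\<lambda>i. p (int i)) ` ?I \<subseteq> {1..int s}"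
      proof clarify
        fix i assume "i \<in> {1..n}" "w (int i) < 0"
        then show "p (int i) \<in> {1..int s}"
          using p_in[of "int i"] q_neg[of "p (int i)"] by (simp add: wqp)
      qed
      show "{1..int s} \<subseteq> (\<lambda>i. p (int i)) ` ?I"
      proof
        fix y assume y: "y \<in> {1..int s}"
        then have "y \<in> p ` {1..int n}" using p(1) s by (simp add: bij_betw_def)
        then obtain x where x: "x \<in> {1..int n}" "y = p x" by blast
        then have "nat x \<in> ?I" "y = p (int (nat x))" using y q_neg[of y] by (auto simp: wqp)
        then show "y \<in> (\<lambda>i. p (int i)) ` ?I" by blast
      qed
    qed
    moreover have "inj_on (\<lambda>i. p (int i)) ?I"
      by (rule inj_onI) (metis injD[OF inj_word_prod] p_def of_nat_eq_iff)
    ultimately have "card ?I = card {1..int s}" using card_image by fastforce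
    then show ?thesis by (simp add: num_neg_def)
  qed
  have perm: "w permutes ({- int n..int n} - {0})" and odd: "\<And>i. w (- i) = - w i"
    using w(1) by (auto simp: BC_def)
  have neg_set: "{k \<in> {1..n}. inv w (int k) < 0} = m ` {1..s}"
  proof
    show "{k \<in> {1..n}. inv w (int k) < 0} \<subseteq> m ` {1..s}"
    proof clarify
      fix k assume k: "k \<in> {1..n}" "inv w (int k) < 0"
      define v where "v = inv w (int k)"
      have wv: "w v = int k" unfolding v_def using permutes_inverses(1)[OF perm] .
      then have "v \<in> {- int n..int n} - {0}"
        using permutes_in_image[OF perm, of v] k by auto
      then have v: "- v \<in> {1..int n}" using k(2) by (auto simp: v_def)
      then have pv: "p (- v) \<in> {1..int n}" by (rule p_in)
      \<comment> \<open>Oddness of \<open>w\<close> moves the negative argument \<open>v\<close> to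
        \<open>- v\<close>, where the values of \<open>p\<close> and \<open>q\<close> are
        known.\<close>
      have "q (p (- v)) = - int k" using odd[of v] wv by (simp add: wqp)
      moreover from this have "p (- v) \<le> int s"
        using q_neg[of "p (- v)"] pv k by simp
      ultimately have "nat (p (- v)) \<in> {1..s}" "m (nat (p (- v))) = k"
        using q(1)[of "nat (p (- v))"] pv by auto
      then show "k \<in> m ` {1..s}" by blast
    qed
    show "m ` {1..s} \<subseteq> {k \<in> {1..n}. inv w (int k) < 0}"
    proof clarify
      fix i assume i: "i \<in> {1..s}"
      then have "int i \<in> p ` {1..int n}" using p(1) s by (simp add: bij_betw_def)
      then obtain v where v: "v \<in> {1..int n}" "int i = p v" by blast
      then have "w (- v) = int (m i)" using odd[of v] q(1)[of i] i by (simp add: wqp)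
      then have "inv w (int (m i)) = - v"
        using permutes_inverses(2)[OF perm, of "- v"] by simp
      then show "m i \<in> {1..n} \<and> inv w (int (m i)) < 0"
        using v m(2)[of i] m(3)[of i] i by simp
    qed
  qed
  \<comment> \<open>Since \<open>m\<close> decreases, the reversed list is the sorted enumeration of
    the set; the reversal in \<open>code_N_list\<close> restores the order of the blocks.\<close>
  have "sorted_wrt (<) (rev (map m [1..<Suc t]))" if "t \<le> s" for t
    using that
  proof (induction t)
    case (Suc t)
    then show ?case using m(1) by auto
  qed simp
  then have "sorted_list_of_set (set (rev (map m [1..<Suc s]))) = rev (map m [1..<Suc s])"
    using sorted_list_of_set.idem_if_sorted_distinct strict_sorted_iff by blast
  moreover have "set (rev (map m [1..<Suc s])) = m ` {1..s}"
    by (simp only: set_rev set_map set_upt atLeastLessThanSuc_atLeastAtMost)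
  ultimately have "code_N_list n w = map m [1..<Suc s]"
    unfolding code_N_list_def neg_set by simp
  then show "code_N n w j = m j" if "1 \<le> j" "j \<le> s" for j
    using that by (simp add: code_N_def del: upt_Suc)
qed

section \<open>Uniqueness and existence of the bottom pipe dream\<close>

lemma concat_map_cong: "(\<And>x. x \<in> set xs \<Longrightarrow> f x = g x) \<Longrightarrow> concat (map f xs) = concat (map g xs)"
  by (metis map_cong)

lemma subword_concat_map: "subword S (concat (map f xs)) = concat (map (\<lambda>x. subword S (f x)) xs)"
  by (induction xs) simp_all

lemma decreasing_countsE:
  assumes "decreasing_counts n D"
  obtains s where "\<And>j k. 1 \<le> j \<Longrightarrow> j < k \<Longrightarrow> k \<le> s \<Longrightarrow> gamma_count n D k < gamma_count n D j"
    and "\<And>k. 1 \<le> k \<Longrightarrow> k \<le> s \<Longrightarrow> 1 \<le> gamma_count n D k" and "\<And>k. s < k \<Longrightarrow> gamma_count n D k = 0"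
proof -
  obtain r where r: "\<And>j k. 1 \<le> j \<Longrightarrow> j < k \<Longrightarrow> k \<le> r \<Longrightarrow> gamma_count n D k < gamma_count n D j"
    "\<And>k. r < k \<Longrightarrow> gamma_count n D k = 0"
    using assms unfolding decreasing_counts_def by blast
  \<comment> \<open>A strictly decreasing sequence may contain 0 as its last term, which is dropped
    here. For \<open>r = 0\<close> both branches give 0, whatever the staircase contains.\<close>
  define s where "s = (if gamma_count n D r = 0 then r - 1 else r)"
  have s_r: "s \<le> r" by (simp add: s_def)
  have pos: "1 \<le> gamma_count n D k" if "1 \<le> k" "k \<le> s" for k
  proof (cases "k = r")
    case True
    then show ?thesis using that by (auto simp: s_def split: if_splits)
  next
    case False
    then have "k < r" using that s_r by linarith
    then show ?thesis using r(1)[of k r] that by simp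
  qed
  have zero: "gamma_count n D k = 0" if "s < k" for k
    using that r(2)[of k] by (cases "k = r") (auto simp: s_def split: if_splits)
  have "gamma_count n D k < gamma_count n D j" if "1 \<le> j" "j < k" "k \<le> s" for j k
    using r(1) that s_r by simp
  from that[OF this pos zero] show thesis .
qed

text \<open>By (1) and (2) the word consists of one descending run per row. The ends
  \<open>e r\<close> and the counts \<open>m k\<close> of these runs are recovered from the signed
  Lehmer code of \<open>w\<close>, so the set of boxes depends on \<open>w\<close> alone.\<close>

lemma bottom_significant_boxes:
  assumes n: "n \<ge> 1" and w: "w \<in> BC n" and D: "D \<in> PD n w"
    and no: "no_elbow_cross n D" and dec: "decreasing_counts n D"
  shows "significant_boxes n D = code_boxes n w"
proof -
  define S where "S = significant_boxes n D"
  define m where "m = gamma_count n D"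
  have Dp: "D \<in> pipe_dreams n" using D by (simp add: PD_def)
  have adj: "\<And>r. 1 \<le> r \<Longrightarrow> r < n \<Longrightarrow> adjusted (scell r) r n S"
    "\<And>k. 1 \<le> k \<Longrightarrow> adjusted (hcell k) 0 n S" and vert: "\<And>k i. Vert k i \<notin> S"
    using no no_elbow_cross_iff[OF n Dp S_def] by blast+
  have "\<exists>e. r \<le> e \<and> e \<le> n \<and> (\<forall>i. r \<le> i \<and> i < n \<longrightarrow> (scell r i \<in> S \<longleftrightarrow> i < e))"
    if "1 \<le> r" "r < n" for r
    using adjusted_initial_segment[OF adj(1)[OF that]] that by simp
  then obtain e where e: "\<And>r. 1 \<le> r \<Longrightarrow> r < n \<Longrightarrow> r \<le> e r \<and> e r \<le> n"
    and eS: "\<And>r i. 1 \<le> r \<Longrightarrow> r \<le> i \<Longrightarrow> i < n \<Longrightarrow> scell r i \<in> S \<longleftrightarrow> i < e r"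
    by (metis le_less_trans)
  have mS: "\<And>i. i < n \<Longrightarrow> hcell k i \<in> S \<longleftrightarrow> i < m k" and m_le: "m k \<le> n" if "1 \<le> k" for k
    using hcell_significant_iff[OF n S_def that adj(2)[OF that] vert] by (auto simp: m_def)
  obtain s where s: "\<And>j k. 1 \<le> j \<Longrightarrow> j < k \<Longrightarrow> k \<le> s \<Longrightarrow> m k < m j"
    "\<And>k. 1 \<le> k \<Longrightarrow> k \<le> s \<Longrightarrow> 1 \<le> m k" "\<And>k. s < k \<Longrightarrow> m k = 0"
    using decreasing_countsE[OF dec] unfolding m_def by blast
  have fin: "finite S" using Dp by (simp add: pipe_dreams_def S_def)
  have block: "block b \<le> s" if "b \<in> S" for b
  proof (rule ccontr)
    assume "\<not> block b \<le> s"
    then have "card {c \<in> S. block c = block b} = 0"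
      using s(3) by (simp add: m_def gamma_count_def S_def)
    then show False using that fin by auto
  qed
  have gamma: "subword S (gamma_reading n k) = rev [0..<m k]" if "1 \<le> k" for k
  proof -
    have "subword S (map (Vert k) [1..<n]) = []" using vert by (intro subword_empty) auto
    moreover have "subword S (row_reading (hcell k) 0 n) = rev [0..<m k]"
      using mS m_le that by (intro subword_row) auto
    ultimately show ?thesis by (simp only: gamma_reading_eq[OF n] subword_append append_Nil2)
  qed
  have stair: "subword S (row_reading (scell r) r n) = rev [r..<e r]" if "1 \<le> r" "r < n" for r
    using e eS that by (intro subword_row) auto
  have "pd_word n D = subword S (reading n s)"
    using pd_word_eq[OF n Dp, of s] block by (simp add: S_def)
  also have "\<dots> = concat (map (\<lambda>k. rev [0..<m k]) (rev [1..<Suc s])) @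
      concat (map (\<lambda>r. rev [r..<e r]) [1..<n])"
    unfolding reading_def stair_reading_eq subword_append subword_concat_map
    using gamma stair by (intro arg_cong2[of _ _ _ _ "(@)"] concat_map_cong) auto
  finally have w_eq: "w = word_prod (concat (map (\<lambda>k. rev [0..<m k]) (rev [1..<Suc s])) @
      concat (map (\<lambda>r. rev [r..<e r]) [1..<n]))"
    using D by (auto simp: PD_def reduced_word_def)
  have m_n: "m k \<le> n" if "1 \<le> k" "k \<le> s" for k using that(1) by (rule m_le)
  have code_L: "code_L n w i = e i - i" if "1 \<le> i" "i < n" for i
    by (rule codes_of_word(1)[OF w w_eq n]) (fact e s m_n that)+
  have num_neg: "num_neg n w = s"
    by (rule codes_of_word(2)[OF w w_eq n]) (fact e s m_n)+
  have code_N: "code_N n w j = m j" if "1 \<le> j" "j \<le> s" for j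
    by (rule codes_of_word(3)[OF w w_eq n]) (fact e s m_n that)+
  have "b \<in> S \<longleftrightarrow> b \<in> code_boxes n w" for b
  proof (cases b)
    case (Stair r j)
    show ?thesis
    proof (cases "1 \<le> r \<and> r < n \<and> 1 \<le> j \<and> j \<le> n - r")
      case True
      then have "b = scell r (r + j - 1)" using Stair by (simp add: scell_def)
      then have "b \<in> S \<longleftrightarrow> r + j - 1 < e r" using eS[of r "r + j - 1"] True by auto
      moreover have "b \<in> code_boxes n w \<longleftrightarrow> j \<le> e r - r"
        using Stair True code_L[of r] by (auto simp: code_boxes_def)
      ultimately show ?thesis using True by auto
    next
      case False
      then have "b \<notin> S"
        using Stair significant_boxes_base[of n D] n by (auto simp: S_def base_def)
      moreover have "b \<notin> code_boxes n w"
      proof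
        assume "b \<in> code_boxes n w"
        then have j: "1 \<le> r" "r \<le> n" "1 \<le> j" "j \<le> code_L n w r"
          using Stair by (auto simp: code_boxes_def)
        \<comment> \<open>The rows of \<open>code_boxes\<close> include row \<open>n\<close>, whose
          code entry is 0.\<close>
        have "{j. n < j \<and> j \<le> n \<and> w (int n) > w (int j)} = {}" by auto
        then have "code_L n w n = 0" by (simp only: code_L_def card.empty)
        then have "r < n" using j by (cases "r = n") auto
        then show False using False j code_L[of r] e[of r] by auto
      qed
      ultimately show ?thesis by simp
    qed
  next
    case (Corner k)
    have "b \<in> S \<longleftrightarrow> 1 \<le> k \<and> 0 < m k"
      using Corner mS[of k 0] n significant_boxes_base[of n D]
      by (auto simp: S_def base_def hcell_def)
    also have "\<dots> \<longleftrightarrow> 1 \<le> k \<and> k \<le> s"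
      using s(2)[of k] s(3)[of k] by (cases "k \<le> s") auto
    also have "\<dots> \<longleftrightarrow> b \<in> code_boxes n w"
      using Corner num_neg by (auto simp: code_boxes_def)
    finally show ?thesis .
  next
    case (Horiz k i)
    have "b \<in> S \<longleftrightarrow> 1 \<le> k \<and> 1 \<le> i \<and> i < n \<and> hcell k i \<in> S"
      using Horiz n significant_boxes_base[of n D] by (auto simp: S_def base_def hcell_def)
    also have "\<dots> \<longleftrightarrow> 1 \<le> k \<and> 1 \<le> i \<and> i < m k"
      using mS[of k i] m_le[of k] by auto
    also have "\<dots> \<longleftrightarrow> 1 \<le> k \<and> k \<le> s \<and> 1 \<le> i \<and> i \<le> m k - 1"
      using s(3)[of k] by (cases "k \<le> s") auto
    also have "\<dots> \<longleftrightarrow> b \<in> code_boxes n w"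
      using Horiz num_neg code_N[of k] by (auto simp: code_boxes_def)
    finally show ?thesis .
  next
    case (Vert k i)
    then show ?thesis using vert by (auto simp: code_boxes_def)
  qed
  then show ?thesis unfolding S_def by blast
qed

text \<open>A reduced word is spread over as many blocks as it has letters, one letter in each.\<close>

lemma PD_nonempty:
  assumes n: "n \<ge> 1" and w: "w \<in> BC n"
  shows "PD n w \<noteq> {}"
proof -
  obtain u where u: "reduced_word n u w" using reduced_word_exists[OF w] by blast
  then have u_less: "set u \<subseteq> {..<n}" by (simp add: reduced_word_def)
  \<comment> \<open>Higher blocks are read first, so the letters are distributed from the last one
    upwards: block \<open>k + 1\<close> holds \<open>v ! k\<close>.\<close>
  define v where "v = rev u"
  define S where "S = (\<lambda>k. hcell (Suc k) (v ! k)) ` {..<length v}"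
  have v_less: "v ! k < n" if "k < length v" for k
    using nth_mem[OF that] u_less by (auto simp: v_def)
  have base: "S \<subseteq> base n"
  proof
    fix b assume "b \<in> S"
    then obtain k where "k < length v" "b = hcell (Suc k) (v ! k)" by (auto simp: S_def)
    then show "b \<in> base n" using v_less[of k] by (auto simp: hcell_def base_def)
  qed
  have gamma: "subword S (gamma_reading n (Suc k)) = [v ! k]" if k: "k < length v" for k
  proof -
    have S_iff: "hcell (Suc k) i \<in> S \<longleftrightarrow> i = v ! k" for i using k by (auto simp: S_def)
    have "subword S (map (hcell (Suc k)) (rev [Suc (v ! k)..<n])) = []"
      "subword S (row_reading (hcell (Suc k)) 0 (v ! k)) = []"
      "subword S (map (Vert (Suc k)) [1..<n]) = []"
      by (intro subword_empty; auto simp: row_reading_def S_iff; auto simp: S_def)+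
    then show ?thesis
      using row_reading_split[of 0 "v ! k" n "hcell (Suc k)"] v_less[OF k] S_iff
      by (simp add: gamma_reading_eq[OF n])
  qed
  have "subword S (reading n T) = rev (take T v)" if "T \<le> length v" for T
    using that
  proof (induction T)
    case 0
    have "subword S (stair_reading n) = []"
      using set_stair_reading[of n] by (intro subword_empty) (auto simp: S_def)
    then show ?case by (simp add: reading_0)
  next
    case (Suc T)
    then show ?case using gamma[of T] by (simp add: reading_Suc take_Suc_conv_app_nth)
  qed
  then have "subword S (reading n (length v)) = u" by (simp add: v_def)
  then have "dream n S \<in> PD n w"
    using u base by (subst PD_dream_iff[OF n base, of "length v"]) (auto simp: S_def)
  then show ?thesis by blast
qed

theorem theorem5p7:
  fixes n :: nat and w :: "int \<Rightarrow> int"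
  assumes "n \<ge> 1" and "w \<in> BC n"
  shows "\<exists>D\<^sub>b.
      D\<^sub>b \<in> PD n w \<and> no_elbow_cross n D\<^sub>b \<and> decreasing_counts n D\<^sub>b \<and>
      (\<forall>D. D \<in> PD n w \<and> no_elbow_cross n D \<and> decreasing_counts n D \<longrightarrow> D = D\<^sub>b) \<and>
      significant_boxes n D\<^sub>b = code_boxes n w \<and>
      (\<forall>D \<in> PD n w. (admissible_move n)\<^sup>*\<^sup>* D D\<^sub>b)"
proof -
  let ?bottom = "\<lambda>D. D \<in> PD n w \<and> no_elbow_cross n D \<and> decreasing_counts n D"
  \<comment> \<open>Induction on the weight: as long as a descending move exists it is applied, and
    where none exists (1) and (2) hold.\<close>
  have descend: "\<exists>E. ?bottom E \<and> (admissible_move n)\<^sup>*\<^sup>* D E" if "D \<in> PD n w" for D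
    using that
  proof (induction "weight n D" arbitrary: D rule: less_induct)
    case less
    show ?case
    proof (cases "movable n w D")
      case True
      then obtain D' where "D' \<in> PD n w" "admissible_move n D D'" "weight n D' < weight n D"
        by (auto simp: movable_def)
      then show ?thesis using less.hyps by (meson converse_rtranclp_into_rtranclp)
    next
      case False
      then show ?thesis using movable_or_bottom[OF assms less.prems] less.prems by blast
    qed
  qed
  have unique: "D = E" if "?bottom D" "?bottom E" for D E
  proof -
    have "D = dream n (significant_boxes n D)"
      using that by (simp add: PD_def dream_significant_boxes)
    also have "\<dots> = dream n (significant_boxes n E)"
      using that bottom_significant_boxes[OF assms] by simp
    also have "\<dots> = E"
      using that by (simp add: PD_def dream_significant_boxes)
    finally show ?thesis .
  qed
  obtain D\<^sub>b where D\<^sub>b: "?bottom D\<^sub>b" using descend PD_nonempty[OF assms] by blast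
  \<comment> \<open>The descent from \<open>D\<close> ends in some pipe dream satisfying (1) and
    (2), which is \<open>D\<^sub>b\<close> by uniqueness.\<close>
  have "(admissible_move n)\<^sup>*\<^sup>* D D\<^sub>b" if "D \<in> PD n w" for D
    using descend[OF that] unique[OF _ D\<^sub>b] by blast
  then show ?thesis
    using D\<^sub>b unique bottom_significant_boxes[OF assms] by (intro exI[of _ D\<^sub>b]) blast
qed

end
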